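(* Let $g:\mathbb{R}^n\to\mathbb{R}\cup\{\infty\}$ be proper, lower semi-continuous and convex, and let $F:\mathbb{R}^n\to\mathbb{R}^n$ be strongly monotone with modulus $\mu>0$ and Lipschitz continuous with Lipschitz constant $L>0$. Let $x^*$ be the solution of $\mathrm{MVI}(F,g)$ and let $\kappa_1,\kappa_2>0$. For every $\lambda\in\left(0,\frac{2\mu}{L^2}\right)$ there exists $\varepsilon>0$ such that for any $\alpha_1\in(1-\varepsilon,1)\cap(0,1)$ and any $\alpha_2>1$, the point $x^*$ is a fixed-time stable equilibrium point of the modified proximal dynamical system $$\dot x=-\rho(x)\,(x-y(x)),$$ where $y(x)=\mathrm{prox}_{\lambda g}(x-\lambda F(x))$ and $$\rho(x)=\begin{cases}0,& y(x)=x,\\ \kappa_1\dfrac{1}{\|x-y(x)\|^{1-\alpha_1}}+\kappa_2\dfrac{1}{\|x-y(x)\|^{1-\alpha_2}},&\text{otherwise.}\end{cases}$$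
   Context: $\mathbb{R}^n$ carries an inner product $\langle\cdot,\cdot\rangle$ with induced norm $\|\cdot\|$. $\mathrm{MVI}(F,g)$ is the mixed variational inequality problem: find $x^*\in\mathrm{dom}\,g=\{x:g(x)<\infty\}$ such that $\langle F(x^* ),x-x^*\rangle+g(x)-g(x^* )\ge 0$ for all $x\in\mathbb{R}^n$. Under the stated assumptions on $F$ and $g$ a solution exists and is unique. $F$ is strongly monotone with modulus $\mu>0$ if $\langle F(x)-F(y),x-y\rangle\ge\mu\|x-y\|^2$ for all $x,y$; Lipschitz continuous with constant $L>0$ if $\|F(x)-F(y)\|\le L\|x-y\|$ for all $x,y$. For a proper lower semi-continuous convex function $w$, $\mathrm{prox}_w(x)=\mathrm{arg\,min}_{z\in\mathbb{R}^n}\left(w(z)+\frac12\|x-z\|^2\right)$. Fixed-time stability: consider $\dot x=X(x)$ with $X:\mathbb{R}^n\to\mathbb{R}^n$ continuous and $X(\bar x)=0$ (the definition presupposes that solutions exist and are uniquely determined in forward time). The equilibrium $\bar x$ is finite-time stable if it is stable in the sense of Lyapunov and there exist a neighborhood $\mathcal N$ of $\bar x$ and a settling-time function $T:\mathcal N\setminus\{\bar x\}\to(0,\infty)$ such that for every $x(0)\in\mathcal N\setminus\{\bar x\}$ the solution satisfies $x(t)\in\mathcal N\setminus\{\bar x\}$ for all $t\in[0,T(x(0)))$ and $\lim_{t\to T(x(0))}x(t)=\bar x$. It is globally finite-time stable if this holds with $\mathcal N=\mathbb{R}^n$. It is fixed-time stable if it is globally finite-time stable and $\sup_{x(0)}T(x(0))<\infty$,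 the supremum being over all initial conditions in $\mathbb{R}^n$ (other than $\bar x$). *)

theory Defs
  imports "HOL-Analysis.Analysis"
begin

section \<open>Extended-real-valued convex functions and the proximal operator\<close>

definition effective_domain :: "('a \<Rightarrow> ereal) \<Rightarrow> 'a set" where
  "effective_domain g = {x. g x < \<infinity>}"

definition proper_fun :: "('a \<Rightarrow> ereal) \<Rightarrow> bool" where
  "proper_fun g \<longleftrightarrow> (\<forall>x. g x \<noteq> -\<infinity>) \<and> effective_domain g \<noteq> {}"

definition lower_semicontinuous :: "('a::topological_space \<Rightarrow> ereal) \<Rightarrow> bool" where
  "lower_semicontinuous g \<longleftrightarrow> (\<forall>x. g x \<le> Liminf (at x) g)"

text \<open>The endpoints of the segment are left out, so that the product of \<open>0\<close> and \<open>\<infinity>\<close>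
  never enters; the inequality is trivial there.\<close>

definition convex_fun :: "('a::real_vector \<Rightarrow> ereal) \<Rightarrow> bool" where
  "convex_fun g \<longleftrightarrow>
     (\<forall>x y. \<forall>t\<in>{0<..<1::real}.
        g ((1 - t) *\<^sub>R x + t *\<^sub>R y) \<le> ereal (1 - t) * g x + ereal t * g y)"

text \<open>The library's \<^const>\<open>arg_min\<close> picks some minimiser; for a proper, lower
  semi-continuous and convex function \<open>w\<close> the minimiser exists and is unique.\<close>

definition prox :: "('a::real_normed_vector \<Rightarrow> ereal) \<Rightarrow> 'a \<Rightarrow> 'a" where
  "prox w x = (ARG_MIN (\<lambda>z. w z + ereal (1 / 2 * (norm (x - z))\<^sup>2)) z. True)"


section \<open>Mixed variational inequalities\<close>

definition strongly_monotone :: "real \<Rightarrow> ('a::real_inner \<Rightarrow> 'a) \<Rightarrow> bool" where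
  "strongly_monotone \<mu> F \<longleftrightarrow> (\<forall>x y. (F x - F y) \<bullet> (x - y) \<ge> \<mu> * (norm (x - y))\<^sup>2)"

definition MVI_solution ::
    "('a::real_inner \<Rightarrow> 'a) \<Rightarrow> ('a \<Rightarrow> ereal) \<Rightarrow> 'a \<Rightarrow> bool" where
  "MVI_solution F g xs \<longleftrightarrow>
     xs \<in> effective_domain g \<and> (\<forall>x. ereal (F xs \<bullet> (x - xs)) + g x - g xs \<ge> 0)"


section \<open>Autonomous differential equations and fixed-time stability\<close>

definition ode_solution ::
    "('a::real_normed_vector \<Rightarrow> 'a) \<Rightarrow> real set \<Rightarrow> (real \<Rightarrow> 'a) \<Rightarrow> bool" where
  "ode_solution X I x \<longleftrightarrow> (\<forall>t\<in>I. (x has_vector_derivative X (x t)) (at t within I))"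

text \<open>Every initial value has a global forward solution, and every forward solution with the
  same initial value, even one that is only defined on a bounded time interval, agrees with it.\<close>

definition forward_well_posed :: "('a::real_normed_vector \<Rightarrow> 'a) \<Rightarrow> bool" where
  "forward_well_posed X \<longleftrightarrow>
     (\<forall>x0. \<exists>x. ode_solution X {0..} x \<and> x 0 = x0 \<and>
        (\<forall>\<tau>>0. \<forall>z. ode_solution X {0..<\<tau>} z \<and> z 0 = x0 \<longrightarrow> (\<forall>t\<in>{0..<\<tau>}. z t = x t)))"

definition lyapunov_stable :: "('a::real_normed_vector \<Rightarrow> 'a) \<Rightarrow> 'a \<Rightarrow> bool" where
  "lyapunov_stable X xb \<longleftrightarrow>
     (\<forall>\<epsilon>>0. \<exists>\<delta>>0. \<forall>x. ode_solution X {0..} x \<and> norm (x 0 - xb) < \<delta> \<longrightarrow>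
        (\<forall>t\<ge>0. norm (x t - xb) < \<epsilon>))"

text \<open>The standing assumptions on the vector field (continuity, equilibrium, solutions
  existing and being unique in forward time) are made part of the notion itself, so that the
  quantification over solutions below cannot be vacuous. The argument \<open>T\<close> is the settling-time
  function; its value at the equilibrium is irrelevant.\<close>

definition finite_time_stable_with ::
    "('a::real_normed_vector \<Rightarrow> 'a) \<Rightarrow> 'a \<Rightarrow> 'a set \<Rightarrow> ('a \<Rightarrow> real) \<Rightarrow> bool" where
  "finite_time_stable_with X xb N T \<longleftrightarrow>
     continuous_on UNIV X \<and> X xb = 0 \<and> forward_well_posed X \<and>
     lyapunov_stable X xb \<and>
     xb \<in> interior N \<and>
     T \<in> N - {xb} \<rightarrow> {0<..} \<and>
     (\<forall>x. ode_solution X {0..} x \<and> x 0 \<in> N - {xb} \<longrightarrow>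
        (\<forall>t\<in>{0..<T (x 0)}. x t \<in> N - {xb}) \<and>
        (x \<longlongrightarrow> xb) (at (T (x 0))))"

definition fixed_time_stable :: "('a::real_normed_vector \<Rightarrow> 'a) \<Rightarrow> 'a \<Rightarrow> bool" where
  "fixed_time_stable X xb \<longleftrightarrow>
     (\<exists>T. finite_time_stable_with X xb UNIV T \<and> bdd_above (T ` (UNIV - {xb})))"


section \<open>The modified proximal dynamical system\<close>

definition prox_point ::
    "('a::real_normed_vector \<Rightarrow> 'a) \<Rightarrow> ('a \<Rightarrow> ereal) \<Rightarrow> real \<Rightarrow> 'a \<Rightarrow> 'a" where
  "prox_point F g l x = prox (\<lambda>z. ereal l * g z) (x - l *\<^sub>R F x)"

definition rho ::
    "('a::real_normed_vector \<Rightarrow> 'a) \<Rightarrow> ('a \<Rightarrow> ereal) \<Rightarrow> real \<Rightarrow> real \<Rightarrow> real \<Rightarrow> real \<Rightarrow> real \<Rightarrow> 'a \<Rightarrow> real"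
  where
  "rho F g l \<kappa>\<^sub>1 \<kappa>\<^sub>2 \<alpha>\<^sub>1 \<alpha>\<^sub>2 x =
     (let y = prox_point F g l x in
      if y = x then 0
      else \<kappa>\<^sub>1 * (1 / norm (x - y) powr (1 - \<alpha>\<^sub>1)) + \<kappa>\<^sub>2 * (1 / norm (x - y) powr (1 - \<alpha>\<^sub>2)))"

definition modified_prox_field ::
    "('a::real_normed_vector \<Rightarrow> 'a) \<Rightarrow> ('a \<Rightarrow> ereal) \<Rightarrow> real \<Rightarrow> real \<Rightarrow> real \<Rightarrow> real \<Rightarrow> real \<Rightarrow> 'a \<Rightarrow> 'a"
  where
  "modified_prox_field F g l \<kappa>\<^sub>1 \<kappa>\<^sub>2 \<alpha>\<^sub>1 \<alpha>\<^sub>2 x =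
     - (rho F g l \<kappa>\<^sub>1 \<kappa>\<^sub>2 \<alpha>\<^sub>1 \<alpha>\<^sub>2 x *\<^sub>R (x - prox_point F g l x))"

end

theory Submission
  imports Defs
begin

text \<open>
  Write \<open>y\<close> for the proximal map of the statement and \<open>r u = u - y u\<close> for its residual. The
  modified system moves along \<open>- r\<close>, only with another speed than the plain system \<open>z' = - r z\<close>:
  the two have the same orbits, run through at different times. Everything is read off from this.

  For \<open>0 < l < 2 * \<mu> / L\<^sup>2\<close> the gradient step \<open>u - l *\<^sub>R F u\<close> contracts distances by some factor
  \<open>q < 1\<close>, and the proximal operator does not expand them, so \<open>y\<close> is a contraction
  (\<open>prox_point_contraction\<close>). Its fixed point is \<open>x\<^sup>*\<close>, since the variational inequality says exactly
  that \<open>- F x\<^sup>*\<close> is a subgradient of \<open>g\<close> at \<open>x\<^sup>*\<close>. The same subgradient gives the affine minorant from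
  which the minimisers that define the proximal operator exist.

  Hence \<open>r\<close> is strongly monotone with modulus \<open>1 - q\<close>. The equation \<open>z' = - z + y z\<close> has a global
  solution by variation of constants and Banach's fixed point theorem (\<open>flow_exists\<close>); this solution
  decays exponentially to \<open>x\<^sup>*\<close> but does not reach it in finite time.

  Let \<open>\<rho>\<close> be the speed. The modified system needs the time \<open>\<integral> 1 / \<rho> (z s) ds\<close> to run through an arc
  of the orbit of \<open>z\<close>. For \<open>d = \<parallel>z - x\<^sup>*\<parallel>\<close> the two powers in \<open>\<rho>\<close> give
  \<open>\<rho> \<ge> c * (d powr \<beta> + d powr - \<beta>)\<close>, and the bounded quantity \<open>arctan (d powr \<beta>)\<close> decreases at least
  at a constant multiple of the rate \<open>1 / \<rho>\<close>. The integral is therefore bounded by a constant that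
  does not depend on the starting point (\<open>elapsed_le_settling_bound\<close>): the whole orbit is run
  through within a bounded time, which is the settling time. Inverting the time change and resting at
  \<open>x\<^sup>*\<close> afterwards gives a solution of the modified system (\<open>trajectory_solution\<close>).

  The field is not Lipschitz at \<open>x\<^sup>*\<close>, so uniqueness needs its own argument. For an arbitrary solution
  \<open>x\<close>, as long as it is not at \<open>x\<^sup>*\<close>, set \<open>a t = \<integral> \<rho> (x u) du\<close> over \<open>{0..t}\<close>. Strong monotonicity of
  \<open>r\<close> makes \<open>\<parallel>x t - z (a t)\<parallel>\<close> nonincreasing, and it starts at \<open>0\<close>; so \<open>x\<close> runs on the orbit of \<open>z\<close>,
  and comparing elapsed times shows that it does so at the times found above
  (\<open>solution_is_time_change\<close>). Lyapunov stability holds since the distance to \<open>x\<^sup>*\<close> never grows.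
\<close>

section \<open>Proximal points and subgradients\<close>

text \<open>The value at \<open>p\<close> is required to be finite, so that a subgradient also provides a point of the
  effective domain and excludes the value \<open>-\<infinity>\<close>.\<close>

definition subgradient :: "('a::real_inner \<Rightarrow> ereal) \<Rightarrow> 'a \<Rightarrow> 'a \<Rightarrow> bool" where
  "subgradient w p v \<longleftrightarrow> (\<exists>c. w p = ereal c \<and> (\<forall>z. ereal (c + v \<bullet> (z - p)) \<le> w z))"

text \<open>Each of the two affine minorants is tested at the base point of the other.\<close>

lemma subgradient_monotone:
  assumes "subgradient w p v" "subgradient w p' v'"
  shows "(v - v') \<bullet> (p - p') \<ge> 0"
proof -
  obtain c c' where "w p = ereal c" "\<And>z. ereal (c + v \<bullet> (z - p)) \<le> w z"
    "w p' = ereal c'" "\<And>z. ereal (c' + v' \<bullet> (z - p')) \<le> w z"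
    using assms unfolding subgradient_def by blast
  then have "c + v \<bullet> (p' - p) \<le> c'" "c' + v' \<bullet> (p - p') \<le> c"
    by (metis ereal_less_eq(3))+
  then show ?thesis
    by (simp add: inner_diff_left inner_diff_right)
qed

text \<open>A continuous \<open>\<phi>\<close> in place of a constant allows the quadratic term of the proximal objective to be
  moved to the right-hand side, where it causes no concern about sums of extended reals.\<close>

lemma lower_semicontinuous_closed_sublevel:
  fixes w :: "'a::metric_space \<Rightarrow> ereal"
  assumes lsc: "lower_semicontinuous w" and \<phi>: "continuous_on UNIV \<phi>"
  shows "closed {z. w z \<le> ereal (\<phi> z)}"
proof -
  have nbhd: "\<forall>\<^sub>F z in nhds x. ereal (\<phi> z) < w z" if x: "ereal (\<phi> x) < w x" for x
  proof -
    obtain a where a: "\<phi> x < a" "ereal a < w x"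
      using ereal_dense2[OF x] by auto
    have "ereal a < Liminf (at x) w"
      using lsc a unfolding lower_semicontinuous_def by (meson less_le_trans)
    then have "\<forall>\<^sub>F z in at x. ereal a < w z"
      by (rule less_LiminfD)
    then have 1: "\<forall>\<^sub>F z in nhds x. ereal a < w z"
      using a by (auto simp: eventually_at_filter elim!: eventually_mono)
    have "(\<phi> \<longlongrightarrow> \<phi> x) (nhds x)"
      using \<phi> by (simp add: continuous_on_eq_continuous_at continuous_at_imp_continuous_within
          isCont_def tendsto_at_iff_tendsto_nhds[symmetric])
    then have "\<forall>\<^sub>F z in nhds x. \<phi> z < a"
      using a by (auto dest: order_tendstoD)
    with 1 show ?thesis
      by eventually_elim (meson ereal_less_eq(3) le_less_trans less_imp_le)
  qed
  have "open {z. ereal (\<phi> z) < w z}"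
  proof (subst open_subopen, intro ballI)
    fix x assume "x \<in> {z. ereal (\<phi> z) < w z}"
    then obtain S where "open S" "x \<in> S" "\<forall>z\<in>S. ereal (\<phi> z) < w z"
      using nbhd[of x] unfolding eventually_nhds by auto
    then show "\<exists>T. open T \<and> x \<in> T \<and> T \<subseteq> {z. ereal (\<phi> z) < w z}"
      by (intro exI[of _ S]) auto
  qed
  moreover have "- {z. w z \<le> ereal (\<phi> z)} = {z. ereal (\<phi> z) < w z}"
    by auto
  ultimately show ?thesis
    by (simp add: closed_def)
qed

text \<open>An affine minorant plus the quadratic term is coercive, so the sublevel sets of the objective
  are compact; the nonempty ones are nested and have a common point.\<close>

lemma proximal_minimiser_exists:
  fixes w :: "'a::euclidean_space \<Rightarrow> ereal"
  assumes lsc: "lower_semicontinuous w" and sub: "subgradient w p\<^sub>0 v\<^sub>0"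
  obtains p where "is_arg_min (\<lambda>z. w z + ereal (1 / 2 * (norm (u - z))\<^sup>2)) (\<lambda>z. True) p"
proof -
  define h where "h = (\<lambda>z. w z + ereal (1 / 2 * (norm (u - z))\<^sup>2))"
  obtain c\<^sub>0 where c0: "w p\<^sub>0 = ereal c\<^sub>0" "\<And>z. ereal (c\<^sub>0 + v\<^sub>0 \<bullet> (z - p\<^sub>0)) \<le> w z"
    using sub unfolding subgradient_def by blast
  have sublevel: "{z. h z \<le> ereal c} = {z. w z \<le> ereal (c - 1 / 2 * (norm (u - z))\<^sup>2)}" for c
  proof -
    have "h z \<le> ereal c \<longleftrightarrow> w z \<le> ereal (c - 1 / 2 * (norm (u - z))\<^sup>2)" for z
      unfolding h_def by (cases "w z") auto
    then show ?thesis by simp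
  qed
  \<comment> \<open>Completing the square bounds the objective below by half the squared distance to \<open>u - v\<^sub>0\<close>,
    up to an additive constant.\<close>
  have lower: "ereal (c\<^sub>0 + v\<^sub>0 \<bullet> (u - p\<^sub>0) + 1 / 2 * (norm (u - z - v\<^sub>0))\<^sup>2 - 1 / 2 * (norm v\<^sub>0)\<^sup>2) \<le> h z" for z
  proof -
    have "c\<^sub>0 + v\<^sub>0 \<bullet> (u - p\<^sub>0) + 1 / 2 * (norm (u - z - v\<^sub>0))\<^sup>2 - 1 / 2 * (norm v\<^sub>0)\<^sup>2
      = c\<^sub>0 + v\<^sub>0 \<bullet> (z - p\<^sub>0) + 1 / 2 * (norm (u - z))\<^sup>2"
      by (simp add: power2_norm_eq_inner inner_diff_left inner_diff_right inner_commute algebra_simps)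
    then show ?thesis
      using c0(2)[of z] unfolding h_def by (cases "w z") auto
  qed
  have compact: "compact {z. h z \<le> ereal c}" for c
  proof -
    define R where "R = sqrt (2 * (\<bar>c\<bar> + \<bar>c\<^sub>0 + v\<^sub>0 \<bullet> (u - p\<^sub>0)\<bar>) + (norm v\<^sub>0)\<^sup>2)"
    have "continuous_on UNIV (\<lambda>z. c - 1 / 2 * (norm (u - z))\<^sup>2)"
      by (intro continuous_intros)
    then have "closed {z. h z \<le> ereal c}"
      unfolding sublevel by (rule lower_semicontinuous_closed_sublevel[OF lsc])
    moreover have "{z. h z \<le> ereal c} \<subseteq> cball (u - v\<^sub>0) R"
    proof
      fix z assume "z \<in> {z. h z \<le> ereal c}"
      then have "ereal (c\<^sub>0 + v\<^sub>0 \<bullet> (u - p\<^sub>0) + 1 / 2 * (norm (u - z - v\<^sub>0))\<^sup>2 - 1 / 2 * (norm v\<^sub>0)\<^sup>2) \<le> ereal c"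
        by (intro order_trans[OF lower[of z]]) simp
      then have "(norm (u - z - v\<^sub>0))\<^sup>2 \<le> 2 * (\<bar>c\<bar> + \<bar>c\<^sub>0 + v\<^sub>0 \<bullet> (u - p\<^sub>0)\<bar>) + (norm v\<^sub>0)\<^sup>2"
        unfolding ereal_less_eq by argo
      then have "norm (u - z - v\<^sub>0) \<le> R"
        unfolding R_def using real_le_rsqrt by blast
      then show "z \<in> cball (u - v\<^sub>0) R"
        by (simp add: dist_norm algebra_simps)
    qed
    ultimately show ?thesis
      by (simp add: compact_eq_bounded_closed bounded_subset[OF bounded_cball])
  qed
  define m where "m = (INF z. h z)"
  have m_le: "m \<le> h z" for z
    unfolding m_def by (rule INF_lower) simp
  have "ereal (c\<^sub>0 + v\<^sub>0 \<bullet> (u - p\<^sub>0) - 1 / 2 * (norm v\<^sub>0)\<^sup>2) \<le> m"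
    unfolding m_def
  proof (rule INF_greatest)
    show "ereal (c\<^sub>0 + v\<^sub>0 \<bullet> (u - p\<^sub>0) - 1 / 2 * (norm v\<^sub>0)\<^sup>2) \<le> h z" for z
      by (rule order_trans[OF _ lower[of z]]) simp
  qed
  moreover have "h p\<^sub>0 < \<infinity>"
    unfolding h_def using c0 by simp
  then have "m < \<infinity>"
    using m_le[of p\<^sub>0] by (rule le_less_trans[rotated])
  ultimately obtain M where M: "m = ereal M"
    by (cases m) auto
  define S where "S = (\<lambda>n::nat. {z. h z \<le> ereal (M + 1 / Suc n)})"
  have "\<Inter> (range S) \<noteq> {}"
  proof (rule compact_nest)
    show "compact (S n)" for n
      unfolding S_def by (rule compact)
    show "S n \<noteq> {}" for n
    proof -
      have "(INF z. h z) < ereal (M + 1 / Suc n)"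
        using M unfolding m_def by simp
      then obtain z where "h z < ereal (M + 1 / Suc n)"
        by (auto simp: INF_less_iff)
      then show ?thesis
        unfolding S_def by (auto intro: less_imp_le)
    qed
    show "S k \<subseteq> S n" if "n \<le> k" for n k
    proof -
      have "1 / real (Suc k) \<le> 1 / real (Suc n)"
        using that by (simp add: frac_le)
      then show ?thesis
        unfolding S_def by (auto elim: order_trans)
    qed
  qed
  then obtain p where "\<And>n. h p \<le> ereal (M + 1 / Suc n)"
    unfolding S_def by auto
  moreover have "(\<lambda>n. ereal (M + 1 / Suc n)) \<longlonglongrightarrow> ereal (M + 0)"
    by (intro tendsto_intros LIMSEQ_Suc[OF lim_1_over_n])
  ultimately have "h p \<le> m"
    using M LIMSEQ_le_const[of "\<lambda>n. ereal (M + 1 / Suc n)" "ereal M" "h p"] by simp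
  then have "is_arg_min h (\<lambda>z. True) p"
    using m_le by (auto simp: is_arg_min_linorder intro: order_trans)
  then show ?thesis
    using that unfolding h_def by blast
qed

text \<open>Fermat's rule: compare \<open>p\<close> with \<open>(1 - t) *\<^sub>R p + t *\<^sub>R z\<close>, divide by \<open>t\<close>, and let \<open>t\<close> tend to \<open>0\<close>.\<close>

lemma proximal_minimiser_subgradient:
  fixes w :: "'a::real_inner \<Rightarrow> ereal"
  assumes convex: "convex_fun w" and sub: "subgradient w p\<^sub>0 v\<^sub>0"
    and min: "is_arg_min (\<lambda>z. w z + ereal (1 / 2 * (norm (u - z))\<^sup>2)) (\<lambda>z. True) p"
  shows "subgradient w p (u - p)"
proof -
  have le: "w p + ereal (1 / 2 * (norm (u - p))\<^sup>2) \<le> w z + ereal (1 / 2 * (norm (u - z))\<^sup>2)" for z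
    using min by (auto simp: is_arg_min_linorder)
  obtain c\<^sub>0 where c0: "w p\<^sub>0 = ereal c\<^sub>0" "\<And>z. ereal (c\<^sub>0 + v\<^sub>0 \<bullet> (z - p\<^sub>0)) \<le> w z"
    using sub unfolding subgradient_def by blast
  have not_minf: "w z \<noteq> -\<infinity>" for z
    using c0(2)[of z] by auto
  obtain c where c: "w p = ereal c"
    using le[of p\<^sub>0] c0(1) not_minf[of p] by (cases "w p") auto
  have "ereal (c + (u - p) \<bullet> (z - p)) \<le> w z" for z
  proof (cases "w z")
    case (real d)
    define A where "A = d - c - (u - p) \<bullet> (z - p)"
    define B where "B = (norm (z - p))\<^sup>2"
    have pert: "0 \<le> A + t / 2 * B" if t: "t \<in> {0<..<1}" for t
    proof -
      define y where "y = (1 - t) *\<^sub>R p + t *\<^sub>R z"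
      have "w y \<le> ereal ((1 - t) * c + t * d)"
        using convex[unfolded convex_fun_def, rule_format, of t p z] t c real
        unfolding y_def by simp
      then have "ereal (c + 1 / 2 * (norm (u - p))\<^sup>2)
          \<le> ereal ((1 - t) * c + t * d + 1 / 2 * (norm (u - y))\<^sup>2)"
        using le[of y] c by (cases "w y") auto
      moreover have "u - y = (u - p) - t *\<^sub>R (z - p)"
        unfolding y_def by (simp add: algebra_simps)
      then have "(norm (u - y))\<^sup>2 = (norm (u - p))\<^sup>2 - 2 * t * ((u - p) \<bullet> (z - p)) + t\<^sup>2 * B"
        unfolding B_def
        by (simp only: power2_norm_eq_inner inner_diff_left[of "u - p"] inner_diff_right[of _ "u - p"])
          (simp add: inner_commute algebra_simps power2_eq_square)
      ultimately have "0 \<le> t * (A + t / 2 * B)"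
        unfolding A_def by (simp add: field_simps power2_eq_square)
      then show ?thesis
        using t by (simp add: zero_le_mult_iff)
    qed
    have "((\<lambda>t. A + t / 2 * B) \<longlongrightarrow> A + 0 / 2 * B) (at_right 0)"
      by (intro tendsto_intros) simp
    moreover have "\<forall>\<^sub>F t in at_right 0. 0 \<le> A + t / 2 * B"
      by (rule eventually_mono[OF eventually_at_right_real[of 0 1]]) (use pert in auto)
    ultimately have "0 \<le> A"
      using tendsto_lowerbound[of _ "A + 0 / 2 * B" "at_right (0::real)" 0] by simp
    then show ?thesis
      using real unfolding A_def by simp
  qed (use not_minf in auto)
  then show ?thesis
    unfolding subgradient_def using c by blast
qed

lemma prox_subgradient:
  fixes w :: "'a::euclidean_space \<Rightarrow> ereal"
  assumes "lower_semicontinuous w" "convex_fun w" "subgradient w p\<^sub>0 v\<^sub>0"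
  shows "subgradient w (prox w u) (u - prox w u)"
proof (rule proximal_minimiser_subgradient[OF assms(2,3)])
  show "is_arg_min (\<lambda>z. w z + ereal (1 / 2 * (norm (u - z))\<^sup>2)) (\<lambda>z. True) (prox w u)"
    unfolding prox_def arg_min_def
    by (rule proximal_minimiser_exists[OF assms(1,3), of u]) (rule someI)
qed

text \<open>Points \<open>p\<close> with \<open>u - p\<close> a subgradient at \<open>p\<close> are the values of the resolvent at \<open>u\<close>. Monotonicity
  makes it firmly nonexpansive; with \<open>u = u'\<close> this includes uniqueness, which identifies a known
  point as a proximal point.\<close>

lemma subgradient_resolvent_nonexpansive:
  assumes "subgradient w p (u - p)" "subgradient w p' (u' - p')"
  shows "norm (p - p') \<le> norm (u - u')"
proof -
  have "(norm (p - p'))\<^sup>2 \<le> (u - u') \<bullet> (p - p')"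
    using subgradient_monotone[OF assms]
    by (simp add: power2_norm_eq_inner inner_diff_left inner_diff_right algebra_simps)
  also have "\<dots> \<le> norm (u - u') * norm (p - p')"
    by (rule norm_cauchy_schwarz)
  finally show ?thesis
    unfolding power2_eq_square by (cases "p = p'") simp_all
qed

lemma lower_semicontinuous_cmult:
  fixes w :: "'a::perfect_space \<Rightarrow> ereal"
  assumes "lower_semicontinuous w" "0 < l"
  shows "lower_semicontinuous (\<lambda>z. ereal l * w z)"
  using assms unfolding lower_semicontinuous_def
  by (auto simp: Liminf_ereal_mult_left intro!: ereal_mult_left_mono)

lemma convex_fun_cmult:
  assumes "convex_fun w" "0 < l"
  shows "convex_fun (\<lambda>z. ereal l * w z)"
  unfolding convex_fun_def
proof (intro allI ballI)
  fix x y :: 'a and t :: real assume t: "t \<in> {0<..<1}"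
  have "ereal l * w ((1 - t) *\<^sub>R x + t *\<^sub>R y) \<le> ereal l * (ereal (1 - t) * w x + ereal t * w y)"
    using assms t unfolding convex_fun_def by (intro ereal_mult_left_mono) auto
  also have "\<dots> = ereal (1 - t) * (ereal l * w x) + ereal t * (ereal l * w y)"
    using \<open>0 < l\<close> t by (cases "w x"; cases "w y") (auto simp: algebra_simps)
  finally show "ereal l * w ((1 - t) *\<^sub>R x + t *\<^sub>R y)
      \<le> ereal (1 - t) * (ereal l * w x) + ereal t * (ereal l * w y)" .
qed

text \<open>The mixed variational inequality is the subgradient inequality for \<open>g\<close> at \<open>xs\<close> with the vector
  \<open>- F xs\<close>, here scaled by \<open>l\<close>.\<close>

lemma MVI_solution_subgradient:
  assumes "proper_fun g" "MVI_solution F g xs" "0 < l"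
  shows "subgradient (\<lambda>z. ereal l * g z) xs (- l *\<^sub>R F xs)"
proof -
  obtain c where c: "g xs = ereal c"
    using assms unfolding proper_fun_def MVI_solution_def effective_domain_def
    by (cases "g xs") auto
  have "ereal (l * c + (- l *\<^sub>R F xs) \<bullet> (z - xs)) \<le> ereal l * g z" for z
  proof (cases "g z")
    case (real d)
    have "ereal (F xs \<bullet> (z - xs)) + g z - g xs \<ge> 0"
      using assms unfolding MVI_solution_def by blast
    then have "0 \<le> l * (F xs \<bullet> (z - xs) + d - c)"
      using real c \<open>0 < l\<close> by simp
    then show ?thesis
      using real by (simp add: algebra_simps)
  next
    case PInf
    then show ?thesis using \<open>0 < l\<close> by simp
  next
    case MInf
    then show ?thesis using assms unfolding proper_fun_def by blast
  qed
  then show ?thesis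
    unfolding subgradient_def using c by auto
qed

lemma gradient_step_lipschitz:
  assumes F: "strongly_monotone \<mu> F" "L-lipschitz_on UNIV F" and "0 < l"
  shows "(norm ((u - l *\<^sub>R F u) - (v - l *\<^sub>R F v)))\<^sup>2 \<le> (1 - 2 * l * \<mu> + l\<^sup>2 * L\<^sup>2) * (norm (u - v))\<^sup>2"
proof -
  have "norm (F u - F v) \<le> L * norm (u - v)"
    using lipschitz_onD[OF F(2), of u v] by (simp add: dist_norm)
  then have "(norm (F u - F v))\<^sup>2 \<le> L\<^sup>2 * (norm (u - v))\<^sup>2"
    by (metis norm_ge_zero power_mono power_mult_distrib)
  then have lip: "l\<^sup>2 * (norm (F u - F v))\<^sup>2 \<le> l\<^sup>2 * (L\<^sup>2 * (norm (u - v))\<^sup>2)"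
    by (simp add: mult_left_mono)
  have "l * (\<mu> * (norm (u - v))\<^sup>2) \<le> l * ((F u - F v) \<bullet> (u - v))"
    using F(1) \<open>0 < l\<close> unfolding strongly_monotone_def by (simp add: mult_left_mono)
  moreover have "(u - l *\<^sub>R F u) - (v - l *\<^sub>R F v) = (u - v) - l *\<^sub>R (F u - F v)"
    by (simp add: algebra_simps)
  then have "(norm ((u - l *\<^sub>R F u) - (v - l *\<^sub>R F v)))\<^sup>2
      = (norm (u - v))\<^sup>2 - 2 * (l * ((F u - F v) \<bullet> (u - v))) + l\<^sup>2 * (norm (F u - F v))\<^sup>2"
    by (simp only: power2_norm_eq_inner)
      (simp add: inner_diff_left inner_diff_right inner_commute algebra_simps power2_eq_square)
  ultimately show ?thesis
    using lip by (simp add: algebra_simps)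
qed

text \<open>The gradient step contributes the factor \<open>sqrt (1 - 2 * l * \<mu> + l\<^sup>2 * L\<^sup>2)\<close>, which is below \<open>1\<close>
  precisely for the admitted step sizes.\<close>

lemma prox_point_contraction:
  fixes g :: "'a::euclidean_space \<Rightarrow> ereal"
  assumes g: "proper_fun g" "lower_semicontinuous g" "convex_fun g"
    and F: "strongly_monotone \<mu> F" "L-lipschitz_on UNIV F" "0 < L"
    and sol: "MVI_solution F g xs" and l: "0 < l" "l < 2 * \<mu> / L\<^sup>2"
  obtains q where "0 \<le> q" "q < 1"
    and "\<And>u v. norm (prox_point F g l u - prox_point F g l v) \<le> q * norm (u - v)"
    and "prox_point F g l xs = xs"
proof -
  define w where "w = (\<lambda>z. ereal l * g z)"
  \<comment> \<open>In fact \<open>q2 \<ge> 0\<close>, because \<open>\<mu> \<le> L\<close>; taking \<open>max 0 q2\<close> below replaces the proof of this.\<close>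
  define q2 where "q2 = 1 - 2 * l * \<mu> + l\<^sup>2 * L\<^sup>2"
  have sub_xs: "subgradient w xs (- l *\<^sub>R F xs)"
    unfolding w_def by (rule MVI_solution_subgradient[OF g(1) sol l(1)])
  have sub: "subgradient w (prox w u) (u - prox w u)" for u
    using lower_semicontinuous_cmult[OF g(2) l(1)] convex_fun_cmult[OF g(3) l(1)] sub_xs
    unfolding w_def by (rule prox_subgradient)
  have step: "norm (prox_point F g l u - prox_point F g l v) \<le> sqrt (max 0 q2) * norm (u - v)" for u v
  proof -
    have "norm (prox_point F g l u - prox_point F g l v) \<le> norm ((u - l *\<^sub>R F u) - (v - l *\<^sub>R F v))"
      unfolding prox_point_def w_def[symmetric]
      by (rule subgradient_resolvent_nonexpansive[OF sub sub])
    also have "\<dots> \<le> sqrt (max 0 q2 * (norm (u - v))\<^sup>2)"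
    proof (rule real_le_rsqrt)
      show "(norm ((u - l *\<^sub>R F u) - (v - l *\<^sub>R F v)))\<^sup>2 \<le> max 0 q2 * (norm (u - v))\<^sup>2"
        using gradient_step_lipschitz[OF F(1,2) l(1), of u v] unfolding q2_def
        by (rule order_trans) (simp add: mult_right_mono)
    qed
    finally show ?thesis
      by (simp add: real_sqrt_mult)
  qed
  have "l * (l * L\<^sup>2) < l * (2 * \<mu>)"
    using l F(3) by (intro mult_strict_left_mono) (auto simp: field_simps)
  then have "q2 < 1"
    unfolding q2_def by (simp add: power2_eq_square algebra_simps)
  moreover have "prox_point F g l xs = xs"
  proof -
    have "subgradient w xs ((xs - l *\<^sub>R F xs) - xs)"
      using sub_xs by simp
    from subgradient_resolvent_nonexpansive[OF sub this, of "xs - l *\<^sub>R F xs"]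
    show ?thesis
      unfolding prox_point_def w_def by simp
  qed
  ultimately show ?thesis
    using step by (intro that[of "sqrt (max 0 q2)"]) auto
qed


section \<open>Differential equations on the half-line\<close>

lemma nonneg_derivative_imp_le:
  fixes f :: "real \<Rightarrow> real"
  assumes I: "is_interval I"
    and der: "\<And>t. t \<in> I \<Longrightarrow> (f has_real_derivative f' t) (at t within I)"
    and nonneg: "\<And>t. t \<in> I \<Longrightarrow> 0 \<le> f' t"
    and st: "s \<in> I" "t \<in> I" "s \<le> t"
  shows "f s \<le> f t"
proof (cases "s = t")
  case False
  have sub: "{s..t} \<subseteq> I"
    using mem_is_interval_1_I[OF I st(1,2)] by auto
  have "\<exists>r\<in>{s<..<t}. f t - f s = (\<lambda>h. f' r * h) (t - s)"
  proof (rule mvt_simple)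
    show "s < t" using False st by simp
    show "(f has_derivative (*) (f' r)) (at r within {s..t})" if "s \<le> r" "r \<le> t" for r
    proof -
      have "r \<in> I" using sub that by auto
      then have "(f has_real_derivative f' r) (at r within {s..t})"
        by (rule has_field_derivative_subset[OF der sub])
      then show ?thesis by (simp add: has_field_derivative_def)
    qed
  qed
  then obtain r where r: "r \<in> {s<..<t}" "f t - f s = f' r * (t - s)"
    by blast
  have "r \<in> I" using sub r(1) by auto
  then have "0 \<le> f' r * (t - s)"
    using nonneg st(3) by (intro mult_nonneg_nonneg) auto
  with r show ?thesis by simp
qed simp

lemma norm_square_has_derivative:
  fixes w :: "real \<Rightarrow> 'a::real_inner"
  assumes "(w has_vector_derivative w') (at t within S)"
  shows "((\<lambda>t. (norm (w t))\<^sup>2) has_real_derivative 2 * (w' \<bullet> w t)) (at t within S)"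
  using bounded_bilinear.has_vector_derivative[OF bounded_bilinear_inner assms assms]
  unfolding power2_norm_eq_inner has_real_derivative_iff_has_vector_derivative
  by (simp add: inner_commute[of "w t" w'])

lemma at_within_half_line_eq:
  fixes t b :: real
  assumes "t < b"
  shows "at t within {0..b} = at t within {0..}"
proof (rule at_within_nhd)
  show "t \<in> {..<b}" using assms by simp
qed auto

lemma antiderivative_half_line:
  fixes f :: "real \<Rightarrow> 'a::banach"
  assumes "continuous_on {0..} f" "0 \<le> t"
  shows "((\<lambda>u. integral {0..u} f) has_vector_derivative f t) (at t within {0..})"
proof -
  have "((\<lambda>u. integral {0..u} f) has_vector_derivative f t) (at t within {0..t + 1})"
    using assms by (intro integral_has_vector_derivative) (auto elim: continuous_on_subset)
  then show ?thesis
    using at_within_half_line_eq[of t "t + 1"] by simp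
qed

text \<open>If the differential equation is known except at time \<open>0\<close> and at one other instant, and the curve is
  continuous throughout, then the curve still satisfies the integral equation, whose
  integrand is continuous; so the differential equation holds at these instants, too. This glues a solution to an equilibrium at the time of arrival.\<close>

lemma ode_solution_removable_instant:
  fixes X :: "'a::banach \<Rightarrow> 'a"
  assumes X: "continuous_on UNIV X" and x: "continuous_on {0..} x"
    and der: "\<And>t. 0 < t \<Longrightarrow> t \<noteq> T \<Longrightarrow> (x has_vector_derivative X (x t)) (at t)"
  shows "ode_solution X {0..} x"
proof -
  have cont: "continuous_on {0..} (\<lambda>t. X (x t))"
    using continuous_on_compose2[OF X x] by simp
  have eq: "x t = x 0 + integral {0..t} (\<lambda>t. X (x t))" if "t \<in> {0..}" for t
  proof -
    have "((\<lambda>t. X (x t)) has_integral (x t - x 0)) {0..t}"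
    proof (rule fundamental_theorem_of_calculus_interior_strong)
      show "finite {T}" by simp
      show "0 \<le> t" using that by simp
      show "(x has_vector_derivative X (x s)) (at s)" if "s \<in> {0<..<t} - {T}" for s
        using that der by simp
      show "continuous_on {0..t} x"
        using x by (rule continuous_on_subset) auto
    qed
    then show ?thesis by (simp add: integral_unique)
  qed
  show ?thesis
    unfolding ode_solution_def
  proof
    fix t :: real assume t: "t \<in> {0..}"
    have "((\<lambda>t. x 0 + integral {0..t} (\<lambda>t. X (x t))) has_vector_derivative X (x t)) (at t within {0..})"
      using has_vector_derivative_add[OF has_vector_derivative_const antiderivative_half_line[OF cont]] t
      by fastforce
    then show "(x has_vector_derivative X (x t)) (at t within {0..})"
      by (rule has_vector_derivative_transform[OF t, rotated]) (use eq in blast)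
  qed
qed

text \<open>The weight \<open>exp (s - t)\<close> on \<open>{0..t}\<close> has mass \<open>1 - exp (- t) < 1\<close>.\<close>

lemma discounted_integral_bound:
  fixes h :: "real \<Rightarrow> 'a::banach"
  assumes "continuous_on {0..} h" and bound: "\<And>s. 0 \<le> s \<Longrightarrow> norm (h s) \<le> B" and t: "0 \<le> t"
  shows "norm (exp (- t) *\<^sub>R integral {0..t} (\<lambda>s. exp s *\<^sub>R h s)) \<le> (1 - exp (- t)) * B"
proof -
  have exp_int: "((\<lambda>s. exp s * B) has_integral (exp t * B - exp 0 * B)) {0..t}"
    using t
    by (intro fundamental_theorem_of_calculus)
      (auto simp: has_real_derivative_iff_has_vector_derivative[symmetric] intro!: derivative_eq_intros)
  have "continuous_on {0..t} h"
    using assms(1) by (rule continuous_on_subset) auto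
  then have "norm (integral {0..t} (\<lambda>s. exp s *\<^sub>R h s)) \<le> integral {0..t} (\<lambda>s. exp s * B)"
    using exp_int bound
    by (intro integral_norm_bound_integral)
      (auto intro!: integrable_continuous_real continuous_intros mult_left_mono)
  also have "\<dots> = exp t * B - B"
    unfolding integral_unique[OF exp_int] by simp
  finally have "exp (- t) * norm (integral {0..t} (\<lambda>s. exp s *\<^sub>R h s)) \<le> exp (- t) * (exp t * B - B)"
    by (intro mult_left_mono) auto
  also have "\<dots> = (1 - exp (- t)) * B"
    by (simp add: algebra_simps exp_minus)
  finally show ?thesis
    by simp
qed


section \<open>The flow of a contraction\<close>

locale contraction_flow =
  fixes y :: "'a::euclidean_space \<Rightarrow> 'a" and q :: real and xs :: 'a
  assumes q: "0 \<le> q" "q < 1"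
    and contraction: "norm (y u - y v) \<le> q * norm (u - v)"
    and fixed: "y xs = xs"
begin

definition residual :: "'a \<Rightarrow> 'a" where
  "residual u = u - y u"

lemma continuous_on_y: "continuous_on UNIV y"
proof -
  have "q-lipschitz_on UNIV y"
    using q contraction by (auto intro!: lipschitz_onI simp: dist_norm)
  then show ?thesis by (rule lipschitz_on_continuous_on)
qed

lemma residual_fixed [simp]: "residual xs = 0"
  by (simp add: residual_def fixed)

lemma residual_strongly_monotone:
  "(1 - q) * (norm (u - v))\<^sup>2 \<le> (residual u - residual v) \<bullet> (u - v)"
proof -
  have "(y u - y v) \<bullet> (u - v) \<le> norm (y u - y v) * norm (u - v)"
    by (rule norm_cauchy_schwarz)
  also have "\<dots> \<le> (q * norm (u - v)) * norm (u - v)"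
    by (intro mult_right_mono contraction) auto
  finally have "(y u - y v) \<bullet> (u - v) \<le> q * (norm (u - v))\<^sup>2"
    by (simp add: power2_eq_square)
  moreover have "residual u - residual v = (u - v) - (y u - y v)"
    by (simp add: residual_def)
  then have "(residual u - residual v) \<bullet> (u - v) = (norm (u - v))\<^sup>2 - (y u - y v) \<bullet> (u - v)"
    by (simp only: inner_diff_left[of "u - v"] power2_norm_eq_inner)
  ultimately show ?thesis
    by (simp add: algebra_simps)
qed

text \<open>The constant \<open>2\<close> replaces the sharper \<open>1 + q\<close> in order to be independent of \<open>q\<close>.\<close>

lemma norm_residual_le: "norm (residual u) \<le> 2 * norm (u - xs)"
proof -
  have "norm (residual u) = norm ((u - xs) - (y u - y xs))"
    by (simp add: residual_def fixed)
  also have "\<dots> \<le> norm (u - xs) + norm (y u - y xs)"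
    by (rule norm_triangle_ineq4)
  also have "\<dots> \<le> norm (u - xs) + q * norm (u - xs)"
    using contraction by simp
  also have "\<dots> \<le> norm (u - xs) + 1 * norm (u - xs)"
    using q by (intro add_left_mono mult_right_mono) auto
  finally show ?thesis by simp
qed

lemma norm_residual_ge: "(1 - q) * norm (u - xs) \<le> norm (residual u)"
proof -
  have "norm (u - xs) \<le> norm (residual u) + norm (y u - y xs)"
    using norm_triangle_ineq[of "residual u" "y u - y xs"] by (simp add: residual_def fixed)
  then show ?thesis
    using contraction[of u xs] by (simp add: algebra_simps)
qed

text \<open>In the form \<open>z t = exp (- t) *\<^sub>R (x\<^sub>0 + \<integral> exp s *\<^sub>R y (z s) ds)\<close> the equation \<open>z' = - z + y z\<close> is a fixed
  point problem whose right-hand side is a \<open>q\<close>-contraction in the supremum norm on the whole half-line,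
  because the exponential weights have mass at most \<open>1\<close>. So one application of Banach's theorem to
  bounded continuous functions gives a global solution.\<close>

lemma flow_exists: "\<exists>z. z 0 = x\<^sub>0 \<and> ode_solution (\<lambda>u. - residual u) {0..} z"
proof -
  \<comment> \<open>Bounded continuous functions live on the whole line; \<open>m\<close> freezes the negative half-line at time \<open>0\<close>.\<close>
  define m :: "real \<Rightarrow> real" where "m = max 0"
  define J where "J u t = integral {0..t} (\<lambda>s. exp s *\<^sub>R y (apply_bcontfun u s))"
    for u :: "real \<Rightarrow>\<^sub>C 'a" and t :: real
  define P where "P u t = exp (- m t) *\<^sub>R (x\<^sub>0 + J u (m t))" for u t
  have m: "0 \<le> m t" "0 \<le> t \<Longrightarrow> m t = t" "continuous_on UNIV m" for t
    unfolding m_def by (auto intro!: continuous_intros)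
  have cont_y: "continuous_on {0..} (\<lambda>s. y (apply_bcontfun u s))" for u :: "real \<Rightarrow>\<^sub>C 'a"
    by (rule continuous_on_compose2[OF continuous_on_y]) auto
  have J_der: "(J u has_vector_derivative exp t *\<^sub>R y (apply_bcontfun u t)) (at t within {0..})"
    if "0 \<le> t" for u t
    unfolding J_def using that
    by (intro antiderivative_half_line continuous_intros cont_y)
  have J_cont: "continuous_on {0..} (J u)" for u
    using J_der has_vector_derivative_continuous
    by (fastforce simp: continuous_on_eq_continuous_within)
  have P_cont: "continuous_on UNIV (P u)" for u
    unfolding P_def
    by (intro continuous_intros m(3) continuous_on_compose2[OF J_cont m(3)]) (use m(1) in auto)
  have P_bound: "norm (P u t) \<le> norm x\<^sub>0 + (norm (y 0) + q * norm u)" for u t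
  proof -
    define B where "B = norm (y 0) + q * norm u"
    have "norm (y (apply_bcontfun u s)) \<le> B" for s
    proof -
      have "norm (y (apply_bcontfun u s)) \<le> norm (y 0) + norm (y (apply_bcontfun u s) - y 0)"
        by (rule norm_triangle_sub)
      also have "\<dots> \<le> norm (y 0) + q * norm (apply_bcontfun u s - 0)"
        by (intro add_left_mono contraction)
      also have "\<dots> \<le> B"
        unfolding B_def using q norm_bounded[of u s] by (simp add: mult_left_mono)
      finally show ?thesis .
    qed
    from discounted_integral_bound[OF cont_y this m(1)]
    have "norm (exp (- m t) *\<^sub>R J u (m t)) \<le> (1 - exp (- m t)) * B"
      unfolding J_def by simp
    also have "\<dots> \<le> 1 * B"
      unfolding B_def using q by (intro mult_right_mono) auto
    finally have "norm (exp (- m t) *\<^sub>R J u (m t)) \<le> B" by simp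
    moreover have "norm (exp (- m t) *\<^sub>R x\<^sub>0) \<le> norm x\<^sub>0"
      using m(1)[of t] by (simp add: mult_left_le_one_le)
    ultimately show ?thesis
      unfolding P_def B_def[symmetric] scaleR_add_right
      by (rule norm_triangle_mono[rotated])
  qed
  define \<Phi> where "\<Phi> u = Bcontfun (P u)" for u
  have \<Phi>: "apply_bcontfun (\<Phi> u) t = P u t" for u t
    unfolding \<Phi>_def using bcontfun_normI[OF P_cont P_bound] by (simp add: Bcontfun_inverse)
  have "dist (\<Phi> u) (\<Phi> v) \<le> q * dist u v" for u v
  proof (rule dist_bound)
    fix t
    have int: "(\<lambda>s. exp s *\<^sub>R y (apply_bcontfun w s)) integrable_on {0..m t}" for w :: "real \<Rightarrow>\<^sub>C 'a"
      by (intro integrable_continuous_real continuous_intros continuous_on_subset[OF cont_y]) auto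
    have "norm (y (apply_bcontfun u s) - y (apply_bcontfun v s)) \<le> q * dist u v" for s
      using contraction[of "apply_bcontfun u s" "apply_bcontfun v s"]
        mult_left_mono[OF dist_bounded[of u s v] q(1)] by (simp add: dist_norm)
    from discounted_integral_bound[OF continuous_on_diff[OF cont_y cont_y] this m(1)]
    have "norm (exp (- m t) *\<^sub>R (J u (m t) - J v (m t))) \<le> (1 - exp (- m t)) * (q * dist u v)"
      unfolding J_def integral_diff[OF int int, symmetric] scaleR_diff_right[of "exp _", symmetric] .
    also have "\<dots> \<le> 1 * (q * dist u v)"
      using q by (intro mult_right_mono) auto
    finally show "dist (apply_bcontfun (\<Phi> u) t) (apply_bcontfun (\<Phi> v) t) \<le> q * dist u v"
      unfolding \<Phi> P_def dist_norm by (simp add: scaleR_add_right scaleR_diff_right)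
  qed
  then obtain u where "\<Phi> u = u"
    using banach_fix_type[OF q, of \<Phi>] by blast
  then have u: "apply_bcontfun u t = exp (- t) *\<^sub>R (x\<^sub>0 + J u t)" if "0 \<le> t" for t
    using \<Phi>[of u t] m(2)[OF that] unfolding P_def by simp
  have "ode_solution (\<lambda>u. - residual u) {0..} (apply_bcontfun u)"
    unfolding ode_solution_def
  proof
    fix t :: real assume t: "t \<in> {0..}"
    have e: "((\<lambda>t. exp (- t)) has_real_derivative - exp (- t)) (at t within {0..})"
      by (auto intro!: derivative_eq_intros)
    have j: "((\<lambda>t. x\<^sub>0 + J u t) has_vector_derivative exp t *\<^sub>R y (apply_bcontfun u t)) (at t within {0..})"
      using has_vector_derivative_add[OF has_vector_derivative_const J_der[of t u]] t by simp
    have "((\<lambda>t. exp (- t) *\<^sub>R (x\<^sub>0 + J u t)) has_vector_derivative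
        exp (- t) *\<^sub>R exp t *\<^sub>R y (apply_bcontfun u t) + (- exp (- t)) *\<^sub>R (x\<^sub>0 + J u t)) (at t within {0..})"
      by (rule has_vector_derivative_scaleR[OF e j])
    moreover have "exp (- t) *\<^sub>R exp t *\<^sub>R y (apply_bcontfun u t) + (- exp (- t)) *\<^sub>R (x\<^sub>0 + J u t)
        = - residual (apply_bcontfun u t)"
      using u[of t] t by (simp add: residual_def exp_minus)
    ultimately have d: "((\<lambda>t. exp (- t) *\<^sub>R (x\<^sub>0 + J u t)) has_vector_derivative
        - residual (apply_bcontfun u t)) (at t within {0..})"
      by (simp only:)
    show "(apply_bcontfun u has_vector_derivative - residual (apply_bcontfun u t)) (at t within {0..})"
      by (rule has_vector_derivative_transform[OF t _ d]) (simp add: u)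
  qed
  moreover have "apply_bcontfun u 0 = x\<^sub>0"
    using u[of 0] by (simp add: J_def)
  ultimately show ?thesis by blast
qed

lemma flow_distance_square_derivative:
  assumes "ode_solution (\<lambda>u. - residual u) {0..} z" "0 \<le> t"
  shows "((\<lambda>t. (norm (z t - xs))\<^sup>2) has_real_derivative - 2 * (residual (z t) \<bullet> (z t - xs)))
    (at t within {0..})"
proof -
  have "(z has_vector_derivative - residual (z t)) (at t within {0..})"
    using assms by (auto simp: ode_solution_def)
  from norm_square_has_derivative[OF has_vector_derivative_diff[OF this has_vector_derivative_const]]
  show ?thesis by simp
qed

lemma flow_weighted_distance_derivative:
  assumes "ode_solution (\<lambda>u. - residual u) {0..} z" "0 \<le> t"
  shows "((\<lambda>t. exp (k * t) * (norm (z t - xs))\<^sup>2) has_real_derivative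
    exp (k * t) * (k * (norm (z t - xs))\<^sup>2 - 2 * (residual (z t) \<bullet> (z t - xs)))) (at t within {0..})"
proof -
  have "((\<lambda>t. exp (k * t)) has_real_derivative k * exp (k * t)) (at t within {0..})"
    by (auto intro!: derivative_eq_intros)
  from DERIV_mult[OF this flow_distance_square_derivative[OF assms]]
  show ?thesis
    by (simp add: right_diff_distrib mult_ac)
qed

text \<open>The rate of decay is bounded as well: since \<open>\<parallel>residual u\<parallel> \<le> 2 * \<parallel>u - xs\<parallel>\<close>, the squared distance
  decreases no faster than \<open>exp (- 4 * t)\<close>.\<close>

lemma flow_avoids_fixed_point:
  assumes z: "ode_solution (\<lambda>u. - residual u) {0..} z" and "z 0 \<noteq> xs" "0 \<le> t"
  shows "z t \<noteq> xs"
proof -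
  have "exp (4 * 0) * (norm (z 0 - xs))\<^sup>2 \<le> exp (4 * t) * (norm (z t - xs))\<^sup>2"
  proof (rule nonneg_derivative_imp_le[where I = "{0..}"
        and f = "\<lambda>t. exp (4 * t) * (norm (z t - xs))\<^sup>2"])
    fix s :: real assume s: "s \<in> {0..}"
    show "((\<lambda>s. exp (4 * s) * (norm (z s - xs))\<^sup>2) has_real_derivative
        exp (4 * s) * (4 * (norm (z s - xs))\<^sup>2 - 2 * (residual (z s) \<bullet> (z s - xs)))) (at s within {0..})"
      using s by (intro flow_weighted_distance_derivative[OF z]) simp
    have "residual (z s) \<bullet> (z s - xs) \<le> norm (residual (z s)) * norm (z s - xs)"
      by (rule norm_cauchy_schwarz)
    also have "\<dots> \<le> (2 * norm (z s - xs)) * norm (z s - xs)"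
      by (intro mult_right_mono norm_residual_le) auto
    finally show "0 \<le> exp (4 * s) * (4 * (norm (z s - xs))\<^sup>2 - 2 * (residual (z s) \<bullet> (z s - xs)))"
      by (simp add: power2_eq_square)
  qed (use \<open>0 \<le> t\<close> in \<open>auto simp: is_interval_1\<close>)
  then show ?thesis
    using \<open>z 0 \<noteq> xs\<close> by auto
qed

lemma flow_exponential_decay:
  assumes z: "ode_solution (\<lambda>u. - residual u) {0..} z" and "0 \<le> t"
  shows "(norm (z t - xs))\<^sup>2 \<le> exp (- (2 * (1 - q) * t)) * (norm (z 0 - xs))\<^sup>2"
proof -
  define k where "k = 2 * (1 - q)"
  have "- (exp (k * 0) * (norm (z 0 - xs))\<^sup>2) \<le> - (exp (k * t) * (norm (z t - xs))\<^sup>2)"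
  proof (rule nonneg_derivative_imp_le[where I = "{0..}"
        and f = "\<lambda>t. - (exp (k * t) * (norm (z t - xs))\<^sup>2)"])
    fix s :: real assume s: "s \<in> {0..}"
    show "((\<lambda>s. - (exp (k * s) * (norm (z s - xs))\<^sup>2)) has_real_derivative
        exp (k * s) * (2 * (residual (z s) \<bullet> (z s - xs)) - k * (norm (z s - xs))\<^sup>2)) (at s within {0..})"
      using DERIV_minus[OF flow_weighted_distance_derivative[OF z, of s k]] s
      by (simp only: atLeast_iff minus_mult_right minus_diff_eq)
    show "0 \<le> exp (k * s) * (2 * (residual (z s) \<bullet> (z s - xs)) - k * (norm (z s - xs))\<^sup>2)"
    proof (rule mult_nonneg_nonneg)
      show "0 \<le> 2 * (residual (z s) \<bullet> (z s - xs)) - k * (norm (z s - xs))\<^sup>2"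
        using residual_strongly_monotone[of "z s" xs] unfolding k_def residual_fixed diff_0_right mult.assoc
        by linarith
    qed simp
  qed (use \<open>0 \<le> t\<close> in \<open>auto simp: is_interval_1\<close>)
  then have "exp (- (k * t)) * (exp (k * t) * (norm (z t - xs))\<^sup>2) \<le> exp (- (k * t)) * (norm (z 0 - xs))\<^sup>2"
    by (intro mult_left_mono) auto
  then show ?thesis
    unfolding k_def by (simp add: mult.assoc[symmetric] exp_add[symmetric])
qed

lemma flow_tendsto_fixed_point:
  assumes z: "ode_solution (\<lambda>u. - residual u) {0..} z"
  shows "(z \<longlongrightarrow> xs) at_top"
proof -
  define k where "k = 2 * (1 - q)"
  have "k > 0" using q by (simp add: k_def)
  have "((\<lambda>t. (norm (z t - xs))\<^sup>2) \<longlongrightarrow> 0) at_top"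
  proof (rule tendsto_sandwich[OF _ _ tendsto_const])
    show "\<forall>\<^sub>F t in at_top. 0 \<le> (norm (z t - xs))\<^sup>2" by simp
    show "\<forall>\<^sub>F t in at_top. (norm (z t - xs))\<^sup>2 \<le> exp (- (k * t)) * (norm (z 0 - xs))\<^sup>2"
      unfolding k_def
      by (rule eventually_mono[OF eventually_ge_at_top[of 0]]) (rule flow_exponential_decay[OF z])
    have "filterlim (\<lambda>t. k * t) at_top at_top"
      using \<open>k > 0\<close> filterlim_tendsto_pos_mult_at_top[OF tendsto_const _ filterlim_ident] by blast
    then have "((\<lambda>t. exp (- (k * t))) \<longlongrightarrow> 0) at_top"
      using filterlim_compose[OF exp_at_bot, of "\<lambda>t. - (k * t)"]
      by (simp add: filterlim_uminus_at_top)
    from tendsto_mult_right[OF this, of "(norm (z 0 - xs))\<^sup>2"]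
    show "((\<lambda>t. exp (- (k * t)) * (norm (z 0 - xs))\<^sup>2) \<longlongrightarrow> 0) at_top"
      by simp
  qed
  from tendsto_real_sqrt[OF this] have "((\<lambda>t. norm (z t - xs)) \<longlongrightarrow> 0) at_top"
    by simp
  then show ?thesis
    by (simp add: tendsto_norm_zero_iff LIM_zero_iff)
qed

end


section \<open>Time change of the flow\<close>

text \<open>A flow along \<open>- residual\<close> with a different speed. The lower bound on \<open>\<rho>\<close> blows up both near \<open>xs\<close>, which
  makes the arrival time finite, and far away from it, which makes it uniform in the starting point.\<close>

locale rescaled_flow = contraction_flow +
  fixes \<rho> :: "'a::euclidean_space \<Rightarrow> real" and c \<beta> :: real
  assumes c: "0 < c" and \<beta>: "0 < \<beta>"
    and speed_ge: "u \<noteq> xs \<Longrightarrow> c * (norm (u - xs) powr \<beta> + norm (u - xs) powr - \<beta>) \<le> \<rho> u"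
    and speed_cont: "continuous_on (- {xs}) \<rho>"
    and field_cont: "continuous_on UNIV (\<lambda>u. - (\<rho> u *\<^sub>R residual u))"
begin

definition field :: "'a \<Rightarrow> 'a" where
  "field u = - (\<rho> u *\<^sub>R residual u)"

lemma field_fixed [simp]: "field xs = 0"
  by (simp add: field_def)

lemma continuous_on_field: "continuous_on UNIV field"
  using field_cont by (simp add: field_def[abs_def])

lemma speed_pos:
  assumes "u \<noteq> xs"
  shows "0 < \<rho> u"
proof -
  have "0 < c * (norm (u - xs) powr \<beta> + norm (u - xs) powr - \<beta>)"
    using assms c by (intro mult_pos_pos add_pos_pos) auto
  then show ?thesis
    using speed_ge[OF assms] by linarith
qed

lemma solution_distance_antimono:
  assumes x: "ode_solution field I x" and I: "is_interval I" "s \<in> I" "t \<in> I" "s \<le> t"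
  shows "norm (x t - xs) \<le> norm (x s - xs)"
proof -
  have "- (norm (x s - xs))\<^sup>2 \<le> - (norm (x t - xs))\<^sup>2"
  proof (rule nonneg_derivative_imp_le[where f = "\<lambda>t. - (norm (x t - xs))\<^sup>2", OF I(1) _ _ I(2-4)])
    fix r assume "r \<in> I"
    then have "(x has_vector_derivative field (x r)) (at r within I)"
      using x by (simp add: ode_solution_def)
    from norm_square_has_derivative[OF has_vector_derivative_diff[OF this has_vector_derivative_const]]
    have "((\<lambda>t. (norm (x t - xs))\<^sup>2) has_real_derivative 2 * ((field (x r) - 0) \<bullet> (x r - xs))) (at r within I)" .
    from DERIV_minus[OF this]
    show "((\<lambda>t. - (norm (x t - xs))\<^sup>2) has_real_derivative
        2 * (\<rho> (x r) * (residual (x r) \<bullet> (x r - xs)))) (at r within I)"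
      by (simp add: field_def)
    show "0 \<le> 2 * (\<rho> (x r) * (residual (x r) \<bullet> (x r - xs)))"
    proof (cases "x r = xs")
      case False
      have "0 \<le> (1 - q) * (norm (x r - xs))\<^sup>2"
        using q by simp
      also have "\<dots> \<le> residual (x r) \<bullet> (x r - xs)"
        using residual_strongly_monotone[of "x r" xs] by simp
      finally show ?thesis
        using speed_pos[OF False] by simp
    qed simp
  qed
  then show ?thesis
    by (simp add: abs_le_square_iff[symmetric])
qed

lemma lyapunov_stable_field: "lyapunov_stable field xs"
  unfolding lyapunov_stable_def
proof (intro allI impI)
  fix \<epsilon> :: real assume "0 < \<epsilon>"
  show "\<exists>\<delta>>0. \<forall>x. ode_solution field {0..} x \<and> norm (x 0 - xs) < \<delta> \<longrightarrow> (\<forall>t\<ge>0. norm (x t - xs) < \<epsilon>)"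
  proof (intro exI[of _ \<epsilon>] conjI allI impI)
    fix x :: "real \<Rightarrow> 'a" and t :: real
    assume x: "ode_solution field {0..} x \<and> norm (x 0 - xs) < \<epsilon>" and "0 \<le> t"
    then have "norm (x t - xs) \<le> norm (x 0 - xs)"
      by (intro solution_distance_antimono[of "{0..}"]) (auto simp: is_interval_ci)
    with x show "norm (x t - xs) < \<epsilon>" by simp
  qed fact
qed

definition settling_bound :: real where
  "settling_bound = pi / (2 * (c * (\<beta> * (1 - q))))"

text \<open>With \<open>p = \<parallel>u - xs\<parallel> powr \<beta>\<close> the bound on \<open>\<rho>\<close> turns, up to the factor \<open>c\<close>, into \<open>p / (1 + p\<^sup>2)\<close>, which is matched
  by the derivative of \<open>arctan p\<close> along the flow.\<close>

lemma slowness_le: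
  assumes "u \<noteq> xs"
  shows "1 / \<rho> u \<le> norm (u - xs) powr \<beta> / (c * (1 + (norm (u - xs) powr \<beta>)\<^sup>2))"
proof -
  define p where "p = norm (u - xs) powr \<beta>"
  have "0 < p" using assms by (simp add: p_def)
  have "c * (p + 1 / p) \<le> \<rho> u"
    using speed_ge[OF assms] by (simp add: p_def powr_minus inverse_eq_divide)
  moreover have "0 < c * (p + 1 / p)"
    using c \<open>0 < p\<close> by (intro mult_pos_pos add_pos_pos) auto
  ultimately have "1 / \<rho> u \<le> 1 / (c * (p + 1 / p))"
    by (intro divide_left_mono) auto
  also have "\<dots> = p / (c * (1 + p\<^sup>2))"
    using \<open>0 < p\<close> c by (simp add: field_simps power2_eq_square)
  finally show ?thesis
    by (simp add: p_def)
qed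

end

text \<open>An orbit of the unscaled flow that does not start at the fixed point. The rescaled system runs
  through the same orbit, and \<open>elapsed s\<close> is the time it needs to get from \<open>z 0\<close> to \<open>z s\<close>.\<close>

locale flow_line = rescaled_flow y q xs \<rho> c \<beta>
  for y :: "'a::euclidean_space \<Rightarrow> 'a" and q xs \<rho> c \<beta> +
  fixes z :: "real \<Rightarrow> 'a"
  assumes flow: "ode_solution (\<lambda>u. - residual u) {0..} z"
    and start: "z 0 \<noteq> xs"
begin

definition elapsed :: "real \<Rightarrow> real" where
  "elapsed s = integral {0..s} (\<lambda>s. 1 / \<rho> (z s))"

lemma z_neq: "0 \<le> s \<Longrightarrow> z s \<noteq> xs"
  using flow_avoids_fixed_point[OF flow start] .

lemma z_derivative: "0 \<le> s \<Longrightarrow> (z has_vector_derivative - residual (z s)) (at s within {0..})"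
  using flow by (simp add: ode_solution_def)

lemma continuous_on_z: "continuous_on {0..} z"
  using z_derivative has_vector_derivative_continuous
  by (fastforce simp: continuous_on_eq_continuous_within)

lemma elapsed_derivative:
  assumes "0 \<le> s"
  shows "(elapsed has_real_derivative 1 / \<rho> (z s)) (at s within {0..})"
proof -
  have "continuous_on {0..} (\<lambda>s. \<rho> (z s))"
    by (rule continuous_on_compose2[OF speed_cont continuous_on_z]) (use z_neq in auto)
  then have "continuous_on {0..} (\<lambda>s. 1 / \<rho> (z s))"
    using speed_pos z_neq by (intro continuous_on_divide continuous_on_const) (auto simp: less_imp_neq[THEN not_sym])
  from antiderivative_half_line[OF this assms] show ?thesis
    by (simp add: elapsed_def[abs_def] has_real_derivative_iff_has_vector_derivative)
qed

lemma continuous_on_elapsed: "continuous_on {0..} elapsed"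
  by (rule DERIV_continuous_on) (use elapsed_derivative in auto)

lemma elapsed_0 [simp]: "elapsed 0 = 0"
  by (simp add: elapsed_def)

lemma elapsed_strict_mono:
  assumes "0 \<le> s" "s < t"
  shows "elapsed s < elapsed t"
proof (rule DERIV_pos_imp_increasing_open[OF assms(2)])
  fix r assume r: "s < r" "r < t"
  then have "at r within {0..} = at r"
    using assms by (intro at_within_interior) simp
  then have "(elapsed has_real_derivative 1 / \<rho> (z r)) (at r)"
    using elapsed_derivative[of r] r assms by simp
  moreover have "0 < 1 / \<rho> (z r)"
    using speed_pos z_neq r assms by simp
  ultimately show "\<exists>D. (elapsed has_real_derivative D) (at r) \<and> 0 < D" by blast
next
  show "continuous_on {s..t} elapsed"
    using continuous_on_elapsed by (rule continuous_on_subset) (use assms in auto)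
qed

lemma elapsed_less_iff:
  assumes "0 \<le> s" "0 \<le> t"
  shows "elapsed s < elapsed t \<longleftrightarrow> s < t"
  using elapsed_strict_mono[of s t] elapsed_strict_mono[of t s] assms
  by (cases s t rule: linorder_cases) auto

lemma elapsed_eq_iff:
  assumes "0 \<le> s" "0 \<le> t"
  shows "elapsed s = elapsed t \<longleftrightarrow> s = t"
  using elapsed_less_iff[of s t] elapsed_less_iff[of t s] assms by force

text \<open>Along the flow \<open>D = \<parallel>z - xs\<parallel>\<^sup>2\<close> satisfies \<open>D' \<le> - 2 * (1 - q) * D\<close>. Hence \<open>p = D powr (\<beta> / 2)\<close> satisfies
  \<open>p' \<le> - \<beta> * (1 - q) * p\<close>, and \<open>arctan p\<close> decreases at least at the rate \<open>\<beta> * (1 - q) * p / (1 + p\<^sup>2)\<close>. So a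
  multiple of \<open>arctan p\<close>, which takes values in a bounded interval only, compensates the growth of the
  elapsed time.\<close>

lemma elapsed_le_settling_bound:
  assumes "0 \<le> s"
  shows "elapsed s \<le> settling_bound"
proof -
  \<comment> \<open>\<open>K\<close> makes the rate \<open>K * \<beta> * (1 - q) * p / (1 + p\<^sup>2)\<close> equal to the bound of \<open>slowness_le\<close>.\<close>
  define K where "K = 1 / (c * (\<beta> * (1 - q)))"
  define D where "D = (\<lambda>s. (norm (z s - xs))\<^sup>2)"
  define p where "p = (\<lambda>s. D s powr (\<beta> / 2))"
  have "0 < K" unfolding K_def using c \<beta> q by simp
  have D_pos: "0 < D s" if "0 \<le> s" for s
    using z_neq[OF that] by (simp add: D_def)
  have p_eq: "p s = norm (z s - xs) powr \<beta>" if "0 \<le> s" for s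
  proof -
    have "D s = norm (z s - xs) powr 2"
      using z_neq[OF that] by (simp add: D_def)
    then show ?thesis
      unfolding p_def by (simp only: powr_powr) simp
  qed
  have "- (elapsed 0 + K * arctan (p 0)) \<le> - (elapsed s + K * arctan (p s))"
  proof (rule nonneg_derivative_imp_le[where f = "\<lambda>s. - (elapsed s + K * arctan (p s))" and I = "{0..}"])
    fix r :: real assume "r \<in> {0..}"
    then have r: "0 \<le> r" by simp
    define R where "R = residual (z r) \<bullet> (z r - xs)"
    have dD: "(D has_real_derivative - 2 * R) (at r within {0..})"
      unfolding D_def R_def by (rule flow_distance_square_derivative[OF flow r])
    have dp: "(p has_real_derivative (\<beta> / 2) * D r powr (\<beta> / 2 - 1) * (- 2 * R)) (at r within {0..})"
      unfolding p_def
      using DERIV_chain2[OF has_real_derivative_powr[OF D_pos[OF r]] dD] .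
    have dp': "(\<beta> / 2) * D r powr (\<beta> / 2 - 1) * (- 2 * R) = - (\<beta> * p r * (R / D r))"
      using D_pos[OF r] by (simp add: p_def powr_diff)
    have da: "((\<lambda>s. arctan (p s)) has_real_derivative
        inverse (1 + (p r)\<^sup>2) * (- (\<beta> * p r * (R / D r)))) (at r within {0..})"
      using DERIV_chain2[OF DERIV_arctan dp] unfolding dp' .
    show "((\<lambda>s. - (elapsed s + K * arctan (p s))) has_real_derivative
        - (1 / \<rho> (z r) + K * (inverse (1 + (p r)\<^sup>2) * (- (\<beta> * p r * (R / D r)))))) (at r within {0..})"
      by (intro DERIV_minus DERIV_add DERIV_cmult elapsed_derivative da r)
    have "1 - q \<le> R / D r"
      using residual_strongly_monotone[of "z r" xs] D_pos[OF r]
      by (simp add: R_def D_def pos_le_divide_eq)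
    then have "K * (\<beta> * (1 - q)) * (p r / (1 + (p r)\<^sup>2)) \<le> K * (\<beta> * (R / D r)) * (p r / (1 + (p r)\<^sup>2))"
      using \<open>0 < K\<close> \<beta> by (intro mult_right_mono mult_left_mono) (auto simp: p_def)
    moreover have "K * (\<beta> * (1 - q)) = 1 / c"
      using q \<beta> by (simp add: K_def)
    then have "K * (\<beta> * (1 - q)) * (p r / (1 + (p r)\<^sup>2)) = p r / (c * (1 + (p r)\<^sup>2))"
      by simp
    ultimately have "1 / \<rho> (z r) \<le> K * (\<beta> * (R / D r)) * (p r / (1 + (p r)\<^sup>2))"
      using slowness_le[OF z_neq[OF r]] unfolding p_eq[OF r] by linarith
    then show "0 \<le> - (1 / \<rho> (z r) + K * (inverse (1 + (p r)\<^sup>2) * (- (\<beta> * p r * (R / D r)))))"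
      by (simp add: divide_inverse mult_ac)
  qed (use assms in \<open>auto simp: is_interval_ci\<close>)
  then have "elapsed s \<le> K * arctan (p 0) - K * arctan (p s)"
    by simp
  also have "\<dots> \<le> K * (pi / 2) - K * 0"
    using \<open>0 < K\<close> arctan_ubound[of "p 0"]
    by (intro diff_mono mult_left_mono) (auto simp: p_def)
  finally show ?thesis
    by (simp add: settling_bound_def K_def mult_ac)
qed

text \<open>Let \<open>a\<close> be the integral of \<open>\<rho>\<close> along \<open>x\<close>. Both \<open>x\<close> and \<open>z \<circ> a\<close> move along \<open>- residual\<close> with the same speed
  \<open>\<rho> (x u)\<close>, so strong monotonicity keeps them from moving apart. Once they agree, \<open>elapsed \<circ> a\<close> has
  derivative \<open>1\<close>, which determines \<open>a\<close>.\<close>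

lemma solution_is_time_change:
  assumes x: "ode_solution field I x" and I: "is_interval I" "0 \<in> I" "I \<subseteq> {0..}"
    and "x 0 = z 0" and t: "t \<in> I" "x t \<noteq> xs"
  shows "\<exists>s\<ge>0. elapsed s = t \<and> x t = z s"
proof -
  define J where "J = {0..t}"
  have "0 \<le> t" using t I by auto
  have J: "is_interval J" "0 \<in> J" "t \<in> J"
    using \<open>0 \<le> t\<close> by (auto simp: J_def is_interval_cc)
  have sub: "J \<subseteq> I"
    using mem_is_interval_1_I[OF I(1,2) t(1)] by (auto simp: J_def)
  have x_neq: "x u \<noteq> xs" if "u \<in> J" for u
    using solution_distance_antimono[OF x I(1), of u t] t sub that by (auto simp: J_def)
  have dx: "(x has_vector_derivative field (x u)) (at u within J)" if "u \<in> J" for u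
    using x sub that by (auto simp: ode_solution_def intro: has_vector_derivative_within_subset)
  then have cont_x: "continuous_on J x"
    using has_vector_derivative_continuous by (fastforce simp: continuous_on_eq_continuous_within)
  have cont_\<rho>: "continuous_on {0..t} (\<lambda>u. \<rho> (x u))"
    unfolding J_def[symmetric]
    by (rule continuous_on_compose2[OF speed_cont cont_x]) (use x_neq in auto)
  define a where "a = (\<lambda>u. integral {0..u} (\<lambda>u. \<rho> (x u)))"
  have da: "(a has_real_derivative \<rho> (x u)) (at u within J)" if "u \<in> J" for u
    unfolding a_def J_def by (rule integral_has_real_derivative[OF cont_\<rho>]) (use that in \<open>simp add: J_def\<close>)
  have [simp]: "a 0 = 0" by (simp add: a_def)
  have a_nonneg: "0 \<le> a u" if "u \<in> J" for u
    using nonneg_derivative_imp_le[OF J(1) da _ J(2) that] that speed_pos[OF x_neq]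
    by (auto simp: J_def less_imp_le)
  then have a_image: "a ` J \<subseteq> {0..}" by auto
  have dz: "((z \<circ> a) has_vector_derivative \<rho> (x u) *\<^sub>R (- residual (z (a u)))) (at u within J)"
    if "u \<in> J" for u
    by (rule vector_diff_chain_within[OF da[OF that, unfolded has_real_derivative_iff_has_vector_derivative]
          has_vector_derivative_within_subset[OF z_derivative[OF a_nonneg[OF that]] a_image]])
  have x_eq: "x u = z (a u)" if "u \<in> J" for u
  proof -
    have "- (norm (x 0 - (z \<circ> a) 0))\<^sup>2 \<le> - (norm (x u - (z \<circ> a) u))\<^sup>2"
    proof (rule nonneg_derivative_imp_le[where f = "\<lambda>u. - (norm (x u - (z \<circ> a) u))\<^sup>2", OF J(1) _ _ J(2) that])
      fix v assume v: "v \<in> J"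
      define m where "m = (residual (x v) - residual (z (a v))) \<bullet> (x v - z (a v))"
      have "(field (x v) - \<rho> (x v) *\<^sub>R (- residual (z (a v)))) \<bullet> (x v - (z \<circ> a) v) = - (\<rho> (x v) * m)"
        by (simp add: field_def m_def inner_diff_left algebra_simps)
      then have "((\<lambda>u. (norm (x u - (z \<circ> a) u))\<^sup>2) has_real_derivative 2 * (- (\<rho> (x v) * m))) (at v within J)"
        using norm_square_has_derivative[OF has_vector_derivative_diff[OF dx[OF v] dz[OF v]]] by simp
      from DERIV_minus[OF this]
      show "((\<lambda>u. - (norm (x u - (z \<circ> a) u))\<^sup>2) has_real_derivative 2 * (\<rho> (x v) * m)) (at v within J)"
        by simp
      have "0 \<le> (1 - q) * (norm (x v - z (a v)))\<^sup>2"
        using q by simp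
      then have "0 \<le> m"
        unfolding m_def using residual_strongly_monotone by (rule order_trans)
      then show "0 \<le> 2 * (\<rho> (x v) * m)"
        using speed_pos[OF x_neq[OF v]] by simp
    qed (use that in \<open>simp add: J_def\<close>)
    then show ?thesis
      using \<open>x 0 = z 0\<close> by simp
  qed
  have de: "((\<lambda>u. elapsed (a u) - u) has_real_derivative 0) (at u within J)" if u: "u \<in> J" for u
  proof -
    have "(elapsed has_vector_derivative 1 / \<rho> (z (a u))) (at (a u) within a ` J)"
      using elapsed_derivative[OF a_nonneg[OF u]] a_image
      by (auto simp: has_real_derivative_iff_has_vector_derivative intro: has_vector_derivative_within_subset)
    from vector_diff_chain_within[OF da[OF u, unfolded has_real_derivative_iff_has_vector_derivative] this]
    have "((\<lambda>u. elapsed (a u)) has_real_derivative \<rho> (x u) * (1 / \<rho> (z (a u)))) (at u within J)"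
      by (simp add: has_real_derivative_iff_has_vector_derivative comp_def)
    moreover have "\<rho> (x u) * (1 / \<rho> (z (a u))) = 1"
      using speed_pos[OF x_neq[OF u]] x_eq[OF u] by simp
    ultimately have "((\<lambda>u. elapsed (a u)) has_real_derivative 1) (at u within J)"
      by simp
    from DERIV_diff[OF this DERIV_ident] show ?thesis by simp
  qed
  have "elapsed (a 0) - 0 \<le> elapsed (a t) - t"
    by (rule nonneg_derivative_imp_le[where f = "\<lambda>u. elapsed (a u) - u", OF J(1) de _ J(2,3)])
      (use \<open>0 \<le> t\<close> in simp_all)
  moreover have "- (elapsed (a 0) - 0) \<le> - (elapsed (a t) - t)"
    by (rule nonneg_derivative_imp_le[where f = "\<lambda>u. - (elapsed (a u) - u)", OF J(1) DERIV_minus[OF de] _ J(2,3)])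
      (use \<open>0 \<le> t\<close> in simp_all)
  ultimately have "elapsed (a t) = t" by simp
  then show ?thesis
    using a_nonneg[OF J(3)] x_eq[OF J(3)] by blast
qed

definition settling_time :: real where
  "settling_time = (SUP s\<in>{0..}. elapsed s)"

definition trajectory :: "real \<Rightarrow> 'a" where
  "trajectory t = (if t < settling_time then z (inv_into {0..} elapsed t) else xs)"

lemma bdd_above_elapsed: "bdd_above (elapsed ` {0..})"
  using elapsed_le_settling_bound by (auto intro!: bdd_aboveI)

lemma settling_time_le: "settling_time \<le> settling_bound"
  unfolding settling_time_def using elapsed_le_settling_bound by (intro cSUP_least) auto

lemma elapsed_less_settling_time:
  assumes "0 \<le> s"
  shows "elapsed s < settling_time"
proof -
  have "elapsed s < elapsed (s + 1)"
    using assms by (intro elapsed_strict_mono) auto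
  also have "\<dots> \<le> settling_time"
    unfolding settling_time_def using assms by (intro cSUP_upper bdd_above_elapsed) auto
  finally show ?thesis .
qed

lemma settling_time_pos: "0 < settling_time"
  using elapsed_less_settling_time[of 0] by simp

lemma elapsed_exceeds:
  assumes "t < settling_time"
  obtains s where "0 \<le> s" "t < elapsed s"
  using assms less_cSUP_iff[OF _ bdd_above_elapsed, of t] unfolding settling_time_def by auto

lemma inv_elapsed: "0 \<le> s \<Longrightarrow> inv_into {0..} elapsed (elapsed s) = s"
  by (rule inv_into_f_f) (auto simp: inj_on_def elapsed_eq_iff)

lemma trajectory_elapsed: "0 \<le> s \<Longrightarrow> trajectory (elapsed s) = z s"
  by (simp add: trajectory_def elapsed_less_settling_time inv_elapsed)

lemma trajectory_settled: "settling_time \<le> t \<Longrightarrow> trajectory t = xs"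
  by (simp add: trajectory_def)

lemma elapsed_image: "0 \<le> s \<Longrightarrow> elapsed ` {0..s} = {0..elapsed s}"
proof
  assume s: "0 \<le> s"
  show "elapsed ` {0..s} \<subseteq> {0..elapsed s}"
    using elapsed_less_iff[of _ 0] elapsed_less_iff[of s] by (force simp: not_less[symmetric])
  show "{0..elapsed s} \<subseteq> elapsed ` {0..s}"
  proof
    fix t assume "t \<in> {0..elapsed s}"
    moreover have "continuous_on {0..s} elapsed"
      using continuous_on_elapsed by (rule continuous_on_subset) auto
    ultimately obtain r where "0 \<le> r" "r \<le> s" "elapsed r = t"
      using IVT'[of elapsed 0 t s] s by auto
    then show "t \<in> elapsed ` {0..s}" by auto
  qed
qed

lemma elapsed_attains:
  assumes "0 \<le> t" "t < settling_time"
  obtains s where "0 \<le> s" "elapsed s = t"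
proof -
  obtain b where "0 \<le> b" "t < elapsed b"
    using elapsed_exceeds[OF assms(2)] .
  then have "t \<in> elapsed ` {0..b}"
    using elapsed_image assms by simp
  then show ?thesis
    using that by auto
qed

lemma continuous_on_inv_elapsed:
  assumes "0 \<le> s"
  shows "continuous_on {0..elapsed s} (inv_into {0..} elapsed)"
  unfolding elapsed_image[OF assms, symmetric]
  by (rule continuous_on_inv)
    (use continuous_on_elapsed inv_elapsed in \<open>auto elim: continuous_on_subset\<close>)

text \<open>Before the settling time this is continuity of the inverse of \<open>elapsed\<close>. At the settling time it
  says that the late part of the orbit, which lies close to \<open>xs\<close>, is all that remains.\<close>

lemma continuous_on_trajectory: "continuous_on {0..} trajectory"
  unfolding continuous_on_eq_continuous_within
proof
  fix t :: real assume "t \<in> {0..}"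
  then have t: "0 \<le> t" by simp
  show "continuous (at t within {0..}) trajectory"
  proof (cases "t < settling_time")
    case True
    then obtain b where b: "0 \<le> b" "t < elapsed b"
      by (rule elapsed_exceeds)
    have "inv_into {0..} elapsed ` {0..elapsed b} \<subseteq> {0..}"
      unfolding elapsed_image[OF b(1), symmetric] using inv_elapsed by auto
    then have "continuous_on {0..elapsed b} (\<lambda>t. z (inv_into {0..} elapsed t))"
      by (rule continuous_on_compose2[OF continuous_on_z continuous_on_inv_elapsed[OF b(1)]])
    moreover have "z (inv_into {0..} elapsed t) = trajectory t" if "t \<in> {0..elapsed b}" for t
      using that elapsed_less_settling_time[OF b(1)] by (simp add: trajectory_def)
    ultimately have "continuous_on {0..elapsed b} trajectory"
      by (rule continuous_on_eq)
    then have "continuous (at t within {0..elapsed b}) trajectory"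
      using t b by (simp add: continuous_on_eq_continuous_within)
    then show ?thesis
      using at_within_half_line_eq[OF b(2)] by simp
  next
    case False
    have "(trajectory \<longlongrightarrow> xs) (at t within {0..})"
    proof (rule tendstoI)
      fix e :: real assume "0 < e"
      then have "\<forall>\<^sub>F s in at_top. dist (z s) xs < e"
        using flow_tendsto_fixed_point[OF flow] by (rule tendstoD[rotated])
      then obtain s0 where s0: "\<And>s. s0 \<le> s \<Longrightarrow> dist (z s) xs < e"
        by (auto simp: eventually_at_top_linorder)
      define s1 where "s1 = max 0 s0"
      have s1: "0 \<le> s1" "s0 \<le> s1" by (auto simp: s1_def)
      have "elapsed s1 < t"
        using elapsed_less_settling_time[OF s1(1)] False by simp
      then have "\<forall>\<^sub>F r in at t within {0..}. elapsed s1 < r"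
        by (rule order_tendstoD(1)[OF tendsto_ident_at])
      then show "\<forall>\<^sub>F r in at t within {0..}. dist (trajectory r) xs < e"
      proof eventually_elim
        case (elim r)
        show ?case
        proof (cases "r < settling_time")
          case True
          have "0 \<le> elapsed s1"
            using elapsed_less_iff[of s1 0] s1 by (simp add: not_less[symmetric])
          then obtain s where s: "0 \<le> s" "elapsed s = r"
            using elapsed_attains[of r] True elim by auto
          then have "s1 < s"
            using elapsed_less_iff[of s1 s] s1 elim by simp
          then show ?thesis
            using s0[of s] s1 s trajectory_elapsed[of s] by simp
        qed (use \<open>0 < e\<close> in \<open>simp add: trajectory_settled\<close>)
      qed
    qed
    then show ?thesis
      using False by (simp add: continuous_within trajectory_settled)
  qed
qed

lemma trajectory_derivative:
  assumes "0 < t" "t \<noteq> settling_time"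
  shows "(trajectory has_vector_derivative field (trajectory t)) (at t)"
proof (cases "t < settling_time")
  case True
  let ?\<sigma> = "inv_into {0..} elapsed"
  obtain s where s: "0 \<le> s" "elapsed s = t"
    using elapsed_attains[of t] True assms by auto
  have \<sigma>: "?\<sigma> t = s"
    using inv_elapsed[OF s(1)] s(2) by simp
  have "0 < s"
    using s assms elapsed_0 by (cases "s = 0") auto
  then have at_s: "at s within {0..} = at s"
    by (intro at_within_interior) simp
  obtain b where b: "0 \<le> b" "t < elapsed b"
    using elapsed_exceeds[OF True] .
  have "isCont ?\<sigma> t"
    by (rule continuous_on_interior[OF continuous_on_inv_elapsed[OF b(1)]])
      (use assms b in simp)
  moreover have "elapsed (?\<sigma> r) = r" if "0 < r" "r < settling_time" for r
    using elapsed_attains[of r] inv_elapsed that by (metis less_imp_le)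
  moreover have "(elapsed has_real_derivative 1 / \<rho> (z s)) (at (?\<sigma> t))"
    using elapsed_derivative[OF s(1)] at_s by (simp add: \<sigma>)
  ultimately have "(?\<sigma> has_real_derivative inverse (1 / \<rho> (z s))) (at t)"
    using assms True speed_pos[OF z_neq[OF s(1)]]
    by (intro DERIV_inverse_function[where f = elapsed and a = 0 and b = settling_time]) auto
  then have "(?\<sigma> has_vector_derivative \<rho> (z s)) (at t)"
    by (simp add: has_real_derivative_iff_has_vector_derivative)
  moreover have "(z has_vector_derivative - residual (z s)) (at (?\<sigma> t))"
    using z_derivative[OF s(1)] at_s by (simp add: \<sigma>)
  ultimately have "((z \<circ> ?\<sigma>) has_vector_derivative \<rho> (z s) *\<^sub>R (- residual (z s))) (at t)"
    by (rule vector_diff_chain_at)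
  moreover have "\<rho> (z s) *\<^sub>R (- residual (z s)) = field (trajectory t)"
    using trajectory_elapsed[OF s(1)] s(2) by (simp add: field_def)
  ultimately have "((z \<circ> ?\<sigma>) has_vector_derivative field (trajectory t)) (at t)"
    by simp
  then show ?thesis
    by (rule has_vector_derivative_transform_within_open[of _ _ _ "{..<settling_time}"])
      (use True in \<open>auto simp: trajectory_def\<close>)
next
  case False
  have "((\<lambda>t. xs) has_vector_derivative field (trajectory t)) (at t)"
    using False by (simp add: trajectory_settled)
  then show ?thesis
    by (rule has_vector_derivative_transform_within_open[of _ _ _ "{settling_time<..}"])
      (use False assms in \<open>auto simp: trajectory_settled\<close>)
qed

lemma trajectory_solution: "ode_solution field {0..} trajectory"
  by (rule ode_solution_removable_instant[OF continuous_on_field continuous_on_trajectory])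
    (rule trajectory_derivative)

lemma trajectory_0: "trajectory 0 = z 0"
  using trajectory_elapsed[of 0] by simp

lemma trajectory_neq:
  assumes "0 \<le> t" "t < settling_time"
  shows "trajectory t \<noteq> xs"
  using elapsed_attains[OF assms] trajectory_elapsed z_neq by metis

text \<open>What is left after the time change is the possibility that \<open>x\<close> reaches \<open>xs\<close> before the trajectory
  does. Then \<open>x\<close> passes, by the intermediate value theorem, through a positive distance from \<open>xs\<close> that is
  smaller than any distance of the trajectory up to then; but off \<open>xs\<close> the two agree.\<close>

lemma solution_eq_trajectory:
  assumes x: "ode_solution field I x" and I: "is_interval I" "0 \<in> I" "I \<subseteq> {0..}"
    and "x 0 = z 0" and t: "t \<in> I"
  shows "x t = trajectory t"
proof -
  have eq: "x u = trajectory u" if "u \<in> I" "x u \<noteq> xs" for u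
    using solution_is_time_change[OF x I \<open>x 0 = z 0\<close> that] trajectory_elapsed by auto
  show ?thesis
  proof (rule ccontr)
    assume neq: "x t \<noteq> trajectory t"
    then have "x t = xs" using eq t by blast
    have "0 \<le> t" using t I by auto
    have sub: "{0..t} \<subseteq> I"
      using mem_is_interval_1_I[OF I(1,2) t] by auto
    \<comment> \<open>Distances are nonincreasing, so \<open>m\<close> is the least distance of the trajectory on \<open>{0..t}\<close>.\<close>
    define m where "m = norm (trajectory t - xs)"
    have "0 < m"
      using neq \<open>x t = xs\<close> by (simp add: m_def)
    have m_le: "m \<le> norm (trajectory u - xs)" if "0 \<le> u" "u \<le> t" for u
      unfolding m_def using that \<open>0 \<le> t\<close>
      by (intro solution_distance_antimono[OF trajectory_solution]) (auto simp: is_interval_ci)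
    have "continuous_on I x"
      using x has_vector_derivative_continuous
      by (fastforce simp: ode_solution_def continuous_on_eq_continuous_within)
    then have "continuous_on {0..t} (\<lambda>u. norm (x u - xs))"
      using sub by (intro continuous_intros) (rule continuous_on_subset)
    moreover have "norm (x t - xs) \<le> m / 2"
      using \<open>x t = xs\<close> \<open>0 < m\<close> by simp
    moreover have "m / 2 \<le> norm (x 0 - xs)"
      using m_le[of 0] \<open>0 \<le> t\<close> \<open>0 < m\<close> by (simp add: trajectory_0 \<open>x 0 = z 0\<close>)
    ultimately obtain u where u: "0 \<le> u" "u \<le> t" "norm (x u - xs) = m / 2"
      using IVT2'[of "\<lambda>u. norm (x u - xs)" t "m / 2" 0] \<open>0 \<le> t\<close> by blast
    then have "x u \<noteq> xs" using \<open>0 < m\<close> by auto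
    then have "x u = trajectory u"
      using eq sub u by auto
    then show False
      using m_le[of u] u \<open>0 < m\<close> by simp
  qed
qed

end

context rescaled_flow
begin

text \<open>Competitors on every interval that starts at \<open>0\<close> are admitted, since bounded and unbounded ones
  both occur in the notions of stability.\<close>

definition unique_forward_solution :: "'a \<Rightarrow> (real \<Rightarrow> 'a) \<Rightarrow> bool" where
  "unique_forward_solution x\<^sub>0 X \<longleftrightarrow> ode_solution field {0..} X \<and> X 0 = x\<^sub>0 \<and>
    (\<forall>I x. ode_solution field I x \<longrightarrow> is_interval I \<longrightarrow> 0 \<in> I \<longrightarrow> I \<subseteq> {0..} \<longrightarrow> x 0 = x\<^sub>0 \<longrightarrow>
      (\<forall>t\<in>I. x t = X t))"

lemma unique_forward_solution_fixed_point: "unique_forward_solution xs (\<lambda>t. xs)"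
  unfolding unique_forward_solution_def
proof (intro conjI allI impI ballI)
  show "ode_solution field {0..} (\<lambda>t. xs)"
    by (simp add: ode_solution_def)
  fix I x t assume "ode_solution field I x" "is_interval I" "0 \<in> I" "I \<subseteq> {0..}" "x 0 = xs" "t \<in> I"
  then show "x t = xs"
    using solution_distance_antimono[of I x 0 t] by auto
qed simp

lemma settling_solution_exists:
  assumes "x\<^sub>0 \<noteq> xs"
  shows "\<exists>T X. 0 < T \<and> T \<le> settling_bound \<and> unique_forward_solution x\<^sub>0 X \<and>
    (\<forall>t\<in>{0..<T}. X t \<noteq> xs) \<and> X T = xs"
proof -
  obtain z where z: "z 0 = x\<^sub>0" "ode_solution (\<lambda>u. - residual u) {0..} z"
    using flow_exists by blast
  interpret flow_line y q xs \<rho> c \<beta> z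
    by unfold_locales (use z assms in auto)
  have "unique_forward_solution x\<^sub>0 trajectory"
    unfolding unique_forward_solution_def z(1)[symmetric]
    by (intro conjI allI impI ballI trajectory_solution trajectory_0 solution_eq_trajectory)
  then show ?thesis
    using settling_time_pos settling_time_le trajectory_settled[OF order_refl]
    by (intro exI[of _ settling_time] exI[of _ trajectory] conjI ballI trajectory_neq) auto
qed

lemma forward_well_posed_field: "forward_well_posed field"
  unfolding forward_well_posed_def
proof
  fix x\<^sub>0
  obtain X where X: "unique_forward_solution x\<^sub>0 X"
    using unique_forward_solution_fixed_point settling_solution_exists by (cases "x\<^sub>0 = xs") blast+
  show "\<exists>x. ode_solution field {0..} x \<and> x 0 = x\<^sub>0 \<and>
      (\<forall>\<tau>>0. \<forall>z. ode_solution field {0..<\<tau>} z \<and> z 0 = x\<^sub>0 \<longrightarrow> (\<forall>t\<in>{0..<\<tau>}. z t = x t))"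
  proof (intro exI[of _ X] conjI allI impI)
    fix \<tau> :: real and z assume "0 < \<tau>" "ode_solution field {0..<\<tau>} z \<and> z 0 = x\<^sub>0"
    moreover from this have "is_interval {0..<\<tau>}" "0 \<in> {0..<\<tau>}" "{0..<\<tau>} \<subseteq> {0..}"
      by (auto simp: is_interval_co)
    ultimately show "\<forall>t\<in>{0..<\<tau>}. z t = X t"
      using X unfolding unique_forward_solution_def by blast
  qed (use X in \<open>auto simp: unique_forward_solution_def\<close>)
qed

theorem fixed_time_stable_field: "fixed_time_stable field xs"
proof -
  define settles where "settles = (\<lambda>x\<^sub>0 T. 0 < T \<and> T \<le> settling_bound \<and>
    (\<exists>X. unique_forward_solution x\<^sub>0 X \<and> (\<forall>t\<in>{0..<T}. X t \<noteq> xs) \<and> X T = xs))"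
  have "\<forall>x\<^sub>0. \<exists>T. x\<^sub>0 \<noteq> xs \<longrightarrow> settles x\<^sub>0 T"
    unfolding settles_def using settling_solution_exists by blast
  from choice[OF this] obtain T where T: "\<And>x\<^sub>0. x\<^sub>0 \<noteq> xs \<Longrightarrow> settles x\<^sub>0 (T x\<^sub>0)"
    by blast
  have T_bounds: "0 < T x\<^sub>0" "T x\<^sub>0 \<le> settling_bound" if "x\<^sub>0 \<noteq> xs" for x\<^sub>0
    using T[OF that] by (auto simp: settles_def)
  have settled: "(\<forall>t\<in>{0..<T (x 0)}. x t \<noteq> xs) \<and> (x \<longlongrightarrow> xs) (at (T (x 0)))"
    if x: "ode_solution field {0..} x" "x 0 \<noteq> xs" for x
  proof -
    obtain X where X: "unique_forward_solution (x 0) X" "\<forall>t\<in>{0..<T (x 0)}. X t \<noteq> xs" "X (T (x 0)) = xs"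
      using T[OF x(2)] unfolding settles_def by blast
    have eq: "x t = X t" if "0 \<le> t" for t
      using X(1)[unfolded unique_forward_solution_def] x(1) is_interval_ci[of 0] that by auto
    note pos = T_bounds(1)[OF x(2)]
    have "at (T (x 0)) within {0..} = at (T (x 0))"
      using pos by (intro at_within_interior) simp
    moreover have "(x has_vector_derivative field (x (T (x 0)))) (at (T (x 0)) within {0..})"
      using x(1) pos by (simp add: ode_solution_def)
    ultimately have "isCont x (T (x 0))"
      using has_vector_derivative_continuous by metis
    then have "(x \<longlongrightarrow> xs) (at (T (x 0)))"
      using eq[of "T (x 0)"] X(3) pos by (simp add: isCont_def)
    then show ?thesis
      using X(2) eq by simp
  qed
  have "finite_time_stable_with field xs UNIV T"
    unfolding finite_time_stable_with_def
    using continuous_on_field forward_well_posed_field lyapunov_stable_field T_bounds(1) settled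
    by simp
  moreover have "bdd_above (T ` (UNIV - {xs}))"
    using T_bounds(2) by (auto intro!: bdd_aboveI)
  ultimately show ?thesis
    unfolding fixed_time_stable_def by blast
qed

end


section \<open>Power-law speeds\<close>

text \<open>Lowering both exponents to a common \<open>\<beta>\<close> costs a factor \<open>2\<close>: for \<open>d \<ge> 1\<close> the term \<open>d powr b\<close> alone
  dominates both powers, and for \<open>d \<le> 1\<close> the term \<open>d powr - a\<close> does.\<close>

lemma powr_sum_dominates:
  fixes d :: real
  assumes d: "0 < d" and \<beta>: "0 < \<beta>" "\<beta> \<le> a" "\<beta> \<le> b"
  shows "(d powr \<beta> + d powr - \<beta>) / 2 \<le> d powr - a + d powr b"
proof (cases "1 \<le> d")
  case True
  then have "d powr - \<beta> \<le> d powr \<beta>" "d powr \<beta> \<le> d powr b"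
    using \<beta> by (auto intro!: powr_mono)
  then have "(d powr \<beta> + d powr - \<beta>) / 2 \<le> d powr b" by simp
  also have "\<dots> \<le> d powr - a + d powr b" by simp
  finally show ?thesis .
next
  case False
  then have "d powr \<beta> \<le> d powr - \<beta>" "d powr - \<beta> \<le> d powr - a"
    using d \<beta> by (auto intro!: powr_mono')
  then have "(d powr \<beta> + d powr - \<beta>) / 2 \<le> d powr - a" by simp
  also have "\<dots> \<le> d powr - a + d powr b" by simp
  finally show ?thesis .
qed

context contraction_flow
begin

definition power_speed :: "real \<Rightarrow> real \<Rightarrow> real \<Rightarrow> real \<Rightarrow> 'a \<Rightarrow> real" where
  "power_speed \<kappa>\<^sub>1 \<kappa>\<^sub>2 \<alpha>\<^sub>1 \<alpha>\<^sub>2 u = (if y u = u then 0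
     else \<kappa>\<^sub>1 * (1 / norm (residual u) powr (1 - \<alpha>\<^sub>1)) + \<kappa>\<^sub>2 * (1 / norm (residual u) powr (1 - \<alpha>\<^sub>2)))"

lemma residual_eq_0_iff: "residual u = 0 \<longleftrightarrow> u = xs"
  using norm_residual_ge[of u] q by (auto simp: mult_le_0_iff)

lemma fixed_point_iff: "y u = u \<longleftrightarrow> u = xs"
  using residual_eq_0_iff[of u] by (auto simp: residual_def)

lemma continuous_on_residual: "continuous_on S residual"
  unfolding residual_def[abs_def]
  by (intro continuous_intros continuous_on_subset[OF continuous_on_y]) auto

lemma power_speed_eq:
  "power_speed \<kappa>\<^sub>1 \<kappa>\<^sub>2 \<alpha>\<^sub>1 \<alpha>\<^sub>2 u =
    \<kappa>\<^sub>1 * norm (residual u) powr (\<alpha>\<^sub>1 - 1) + \<kappa>\<^sub>2 * norm (residual u) powr (\<alpha>\<^sub>2 - 1)"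
  if "u \<noteq> xs"
proof -
  have "1 / norm (residual u) powr (1 - \<alpha>) = norm (residual u) powr (\<alpha> - 1)" for \<alpha>
    using powr_minus_divide[of "norm (residual u)" "1 - \<alpha>"] by simp
  then show ?thesis
    using that by (simp add: power_speed_def fixed_point_iff)
qed

text \<open>The norm of the residual is comparable with the distance to the fixed point, from above for the
  decreasing power and from below for the increasing one.\<close>

lemma power_speed_lower_bound:
  assumes \<kappa>: "0 < \<kappa>\<^sub>1" "0 < \<kappa>\<^sub>2" and \<alpha>: "\<alpha>\<^sub>1 < 1" "1 < \<alpha>\<^sub>2"
  obtains c \<beta> where "0 < c" "0 < \<beta>"
    "\<And>u. u \<noteq> xs \<Longrightarrow> c * (norm (u - xs) powr \<beta> + norm (u - xs) powr - \<beta>) \<le> power_speed \<kappa>\<^sub>1 \<kappa>\<^sub>2 \<alpha>\<^sub>1 \<alpha>\<^sub>2 u"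
proof -
  define c\<^sub>1 where "c\<^sub>1 = \<kappa>\<^sub>1 * 2 powr (\<alpha>\<^sub>1 - 1)"
  define c\<^sub>2 where "c\<^sub>2 = \<kappa>\<^sub>2 * (1 - q) powr (\<alpha>\<^sub>2 - 1)"
  define c where "c = min c\<^sub>1 c\<^sub>2"
  define \<beta> where "\<beta> = min (1 - \<alpha>\<^sub>1) (\<alpha>\<^sub>2 - 1)"
  have "0 < c" "0 < \<beta>"
    using \<kappa> \<alpha> q by (auto simp: c_def c\<^sub>1_def c\<^sub>2_def \<beta>_def)
  moreover have "c / 2 * (norm (u - xs) powr \<beta> + norm (u - xs) powr - \<beta>) \<le> power_speed \<kappa>\<^sub>1 \<kappa>\<^sub>2 \<alpha>\<^sub>1 \<alpha>\<^sub>2 u"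
    if u: "u \<noteq> xs" for u
  proof -
    define d where "d = norm (u - xs)"
    define n where "n = norm (residual u)"
    have "0 < d" "0 < n" using u by (auto simp: d_def n_def residual_eq_0_iff)
    have "n \<le> 2 * d" "(1 - q) * d \<le> n"
      unfolding n_def d_def by (rule norm_residual_le norm_residual_ge)+
    have "c * d powr - (1 - \<alpha>\<^sub>1) \<le> c\<^sub>1 * d powr (\<alpha>\<^sub>1 - 1)"
      by (simp add: c_def mult_right_mono)
    also have "\<dots> = \<kappa>\<^sub>1 * (2 * d) powr (\<alpha>\<^sub>1 - 1)"
      using \<open>0 < d\<close> by (simp add: c\<^sub>1_def powr_mult)
    also have "\<dots> \<le> \<kappa>\<^sub>1 * n powr (\<alpha>\<^sub>1 - 1)"
      using \<kappa> \<alpha> \<open>0 < n\<close> \<open>n \<le> 2 * d\<close> by (intro mult_left_mono powr_mono2') auto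
    finally have 1: "c * d powr - (1 - \<alpha>\<^sub>1) \<le> \<kappa>\<^sub>1 * n powr (\<alpha>\<^sub>1 - 1)" .
    have "c * d powr (\<alpha>\<^sub>2 - 1) \<le> c\<^sub>2 * d powr (\<alpha>\<^sub>2 - 1)"
      by (simp add: c_def mult_right_mono)
    also have "\<dots> = \<kappa>\<^sub>2 * ((1 - q) * d) powr (\<alpha>\<^sub>2 - 1)"
      using \<open>0 < d\<close> q by (simp add: c\<^sub>2_def powr_mult)
    also have "\<dots> \<le> \<kappa>\<^sub>2 * n powr (\<alpha>\<^sub>2 - 1)"
      using \<kappa> \<alpha> q \<open>0 < d\<close> \<open>(1 - q) * d \<le> n\<close> by (intro mult_left_mono powr_mono2) auto
    finally have 2: "c * d powr (\<alpha>\<^sub>2 - 1) \<le> \<kappa>\<^sub>2 * n powr (\<alpha>\<^sub>2 - 1)" .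
    have "c * ((d powr \<beta> + d powr - \<beta>) / 2) \<le> c * (d powr - (1 - \<alpha>\<^sub>1) + d powr (\<alpha>\<^sub>2 - 1))"
      using \<open>0 < c\<close> \<open>0 < d\<close> \<open>0 < \<beta>\<close> by (intro mult_left_mono powr_sum_dominates) (auto simp: \<beta>_def)
    also have "\<dots> \<le> \<kappa>\<^sub>1 * n powr (\<alpha>\<^sub>1 - 1) + \<kappa>\<^sub>2 * n powr (\<alpha>\<^sub>2 - 1)"
      unfolding distrib_left by (rule add_mono[OF 1 2])
    finally show ?thesis
      using power_speed_eq[OF u] by (simp add: d_def n_def)
  qed
  ultimately show ?thesis
    using that[of "c / 2" \<beta>] by simp
qed

lemma continuous_on_power_speed: "continuous_on (- {xs}) (power_speed \<kappa>\<^sub>1 \<kappa>\<^sub>2 \<alpha>\<^sub>1 \<alpha>\<^sub>2)"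
proof -
  have "continuous_on (- {xs}) (\<lambda>u. \<kappa>\<^sub>1 * norm (residual u) powr (\<alpha>\<^sub>1 - 1) + \<kappa>\<^sub>2 * norm (residual u) powr (\<alpha>\<^sub>2 - 1))"
    by (intro continuous_intros continuous_on_residual) (auto simp: residual_eq_0_iff)
  then show ?thesis
    by (rule continuous_on_eq) (simp add: power_speed_eq)
qed

text \<open>The speed may be unbounded near the fixed point, but multiplied with the residual it leaves the
  positive powers \<open>\<alpha>\<^sub>1\<close> and \<open>\<alpha>\<^sub>2\<close> of its norm, which tend to \<open>0\<close>.\<close>

lemma continuous_on_power_field:
  assumes \<alpha>: "0 < \<alpha>\<^sub>1" "0 < \<alpha>\<^sub>2"
  shows "continuous_on UNIV (\<lambda>u. - (power_speed \<kappa>\<^sub>1 \<kappa>\<^sub>2 \<alpha>\<^sub>1 \<alpha>\<^sub>2 u *\<^sub>R residual u))"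
proof -
  define X where "X = (\<lambda>u. - (power_speed \<kappa>\<^sub>1 \<kappa>\<^sub>2 \<alpha>\<^sub>1 \<alpha>\<^sub>2 u *\<^sub>R residual u))"
  define b where "b = (\<lambda>u. \<bar>\<kappa>\<^sub>1\<bar> * norm (residual u) powr \<alpha>\<^sub>1 + \<bar>\<kappa>\<^sub>2\<bar> * norm (residual u) powr \<alpha>\<^sub>2)"
  have bound: "norm (X u) \<le> b u" for u
  proof (cases "u = xs")
    case False
    define n where "n = norm (residual u)"
    have "0 < n" using False by (simp add: n_def residual_eq_0_iff)
    have pow: "n powr (\<alpha> - 1) * n = n powr \<alpha>" for \<alpha>
      using \<open>0 < n\<close> by (simp add: powr_diff)
    have "norm (X u) = \<bar>\<kappa>\<^sub>1 * n powr (\<alpha>\<^sub>1 - 1) + \<kappa>\<^sub>2 * n powr (\<alpha>\<^sub>2 - 1)\<bar> * n"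
      using power_speed_eq[OF False] by (simp add: X_def n_def)
    also have "\<dots> \<le> (\<bar>\<kappa>\<^sub>1\<bar> * n powr (\<alpha>\<^sub>1 - 1) + \<bar>\<kappa>\<^sub>2\<bar> * n powr (\<alpha>\<^sub>2 - 1)) * n"
      using \<open>0 < n\<close>
      by (intro mult_right_mono order_trans[OF abs_triangle_ineq]) (auto simp: abs_mult)
    also have "\<dots> = b u"
      by (simp add: b_def distrib_right mult.assoc pow flip: n_def)
    finally show ?thesis .
  qed (simp add: X_def b_def)
  have "isCont X u" for u
  proof (cases "u = xs")
    case True
    have "continuous_on UNIV b"
      unfolding b_def using \<alpha>
      by (intro continuous_on_add continuous_on_mult continuous_on_const continuous_on_powr'
          continuous_on_norm continuous_on_residual) auto
    then have "b \<midarrow>xs\<rightarrow> b xs"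
      by (simp add: continuous_on_eq_continuous_at isCont_def)
    then have "b \<midarrow>xs\<rightarrow> 0"
      by (simp add: b_def)
    then have "X \<midarrow>xs\<rightarrow> 0"
      by (rule Lim_null_comparison[rotated]) (simp add: bound)
    then show ?thesis
      by (simp add: True isCont_def X_def)
  next
    case False
    have "continuous_on (- {xs}) X"
      unfolding X_def
      by (intro continuous_intros continuous_on_power_speed continuous_on_residual)
    then show ?thesis
      using False by (simp add: continuous_on_eq_continuous_at open_Compl)
  qed
  then show ?thesis
    unfolding X_def by (simp add: continuous_on_eq_continuous_at)
qed

theorem fixed_time_stable_power_field:
  assumes "0 < \<kappa>\<^sub>1" "0 < \<kappa>\<^sub>2" "0 < \<alpha>\<^sub>1" "\<alpha>\<^sub>1 < 1" "1 < \<alpha>\<^sub>2"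
  shows "fixed_time_stable (\<lambda>u. - (power_speed \<kappa>\<^sub>1 \<kappa>\<^sub>2 \<alpha>\<^sub>1 \<alpha>\<^sub>2 u *\<^sub>R residual u)) xs"
proof -
  obtain c \<beta> where "0 < c" "0 < \<beta>"
    "\<And>u. u \<noteq> xs \<Longrightarrow> c * (norm (u - xs) powr \<beta> + norm (u - xs) powr - \<beta>) \<le> power_speed \<kappa>\<^sub>1 \<kappa>\<^sub>2 \<alpha>\<^sub>1 \<alpha>\<^sub>2 u"
    using power_speed_lower_bound assms by blast
  then interpret rescaled_flow y q xs "power_speed \<kappa>\<^sub>1 \<kappa>\<^sub>2 \<alpha>\<^sub>1 \<alpha>\<^sub>2" c \<beta>
    using assms by unfold_locales (auto intro: continuous_on_power_speed continuous_on_power_field)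
  show ?thesis
    using fixed_time_stable_field unfolding field_def[abs_def] .
qed

end

section \<open>The modified proximal dynamical system\<close>

theorem theorem2:
  fixes g :: "'a::euclidean_space \<Rightarrow> ereal"
    and F :: "'a \<Rightarrow> 'a"
    and xs :: 'a
    and \<mu> L \<kappa>\<^sub>1 \<kappa>\<^sub>2 :: real
  assumes "proper_fun g" and "lower_semicontinuous g" and "convex_fun g"
    and "\<mu> > 0" and "strongly_monotone \<mu> F"
    and "L > 0" and "L-lipschitz_on UNIV F"
    and "MVI_solution F g xs"
    and "\<kappa>\<^sub>1 > 0" and "\<kappa>\<^sub>2 > 0"
  shows "\<forall>l\<in>{0<..<2 * \<mu> / L\<^sup>2}. \<exists>\<epsilon>>0.
           \<forall>\<alpha>\<^sub>1\<in>{1 - \<epsilon><..<1} \<inter> {0<..<1}. \<forall>\<alpha>\<^sub>2>1.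
             fixed_time_stable (modified_prox_field F g l \<kappa>\<^sub>1 \<kappa>\<^sub>2 \<alpha>\<^sub>1 \<alpha>\<^sub>2) xs"
proof
  fix l assume "l \<in> {0<..<2 * \<mu> / L\<^sup>2}"
  then have l: "0 < l" "l < 2 * \<mu> / L\<^sup>2" by auto
  obtain q where "0 \<le> q" "q < 1"
    "\<And>u v. norm (prox_point F g l u - prox_point F g l v) \<le> q * norm (u - v)"
    "prox_point F g l xs = xs"
    using prox_point_contraction[OF assms(1-3,5,7,6,8) l] by blast
  then interpret contraction_flow "prox_point F g l" q xs
    by unfold_locales
  have field: "modified_prox_field F g l \<kappa>\<^sub>1 \<kappa>\<^sub>2 \<alpha>\<^sub>1 \<alpha>\<^sub>2
      = (\<lambda>u. - (power_speed \<kappa>\<^sub>1 \<kappa>\<^sub>2 \<alpha>\<^sub>1 \<alpha>\<^sub>2 u *\<^sub>R residual u))" for \<alpha>\<^sub>1 \<alpha>\<^sub>2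
    by (simp add: fun_eq_iff modified_prox_field_def rho_def power_speed_def residual_def Let_def)
  show "\<exists>\<epsilon>>0. \<forall>\<alpha>\<^sub>1\<in>{1 - \<epsilon><..<1} \<inter> {0<..<1}. \<forall>\<alpha>\<^sub>2>1.
      fixed_time_stable (modified_prox_field F g l \<kappa>\<^sub>1 \<kappa>\<^sub>2 \<alpha>\<^sub>1 \<alpha>\<^sub>2) xs"
    \<comment> \<open>For \<open>\<epsilon> = 1\<close> the exponent \<open>\<alpha>\<^sub>1\<close> ranges over all of \<open>{0<..<1}\<close>.\<close>
    unfolding field using assms(9,10)
    by (intro exI[of _ 1]) (auto intro: fixed_time_stable_power_field)
qed

end
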